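(* Let $N,K$ be integers with $\left\lceil\frac{K+1}{2}\right\rceil\le N\le K$. For the $(N,K)$ cache network, the exact rate memory tradeoff is given by $$R^{*}(M)=\frac{KN-1}{K(N-1)}-\frac{1}{N-1}M,$$ where $$M\ \ge\ \frac{N}{K}\Big(K-2+\frac{K-2+1/N}{K-1}\Big).$$
   Context: The $(N,K)$ cache network ($1\le N\le K$): a server holds $N$ files and is connected by an error-free broadcast link to $K$ users $U_1,\dots,U_K$, each with its own cache of size $M\in[0,N]$. Write $[L]=\{1,\dots,L\}$. Scheme. Fix real numbers $M\in[0,N]$, $R\ge 0$. A caching scheme with cache size $M$ and rate $R$ consists of a positive integer $F$ (file size in bits) and the following. The files $W_1,\dots,W_N$ are independent and uniformly distributed on $\{0,1\}^F$. For each $k\in[K]$ the cache content $Z_k$ of user $U_k$ is a deterministic function of $(W_1,\dots,W_N)$ consisting of at most $MF$ bits. A demand is $\mathbf d=(d(1),\dots,d(K))\in[N]^K$, meaning that $U_k$ requests $W_{d(k)}$. $\mathbf D$ is the set of demands in which each of the $N$ files is requested by at least one user. For each $\mathbf d\in\mathbf D$ the broadcast $X_{\mathbf d}$ is a deterministic function of $(W_1,\dots,W_N)$ consisting of at most $RF$ bits, such that for every $k\in[K]$ the file $W_{d(k)}$ is determined by $(Z_k,X_{\mathbf d})$. (The caches do not depend on the demand.) Entropy $H$ is Shannon entropy in bits divided by $F$, so $H(W_n)=1$. Symmetric scheme. A scheme is symmetric if for all permutations $\pi$ of $[K]$ and $\sigma$ of $[N]$ and all $A\subseteq[N]$, $B\subseteq[K]$,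 $E\subseteq\mathbf D$, $$H\big((W_n)_{n\in A},(Z_k)_{k\in B},(X_{\mathbf d})_{\mathbf d\in E}\big)=H\big((W_{\sigma(n)})_{n\in A},(Z_{\pi(k)})_{k\in B},(X_{\sigma\circ\mathbf d\circ\pi^{-1}})_{\mathbf d\in E}\big).$$ Throughout, only symmetric schemes are considered: a pair $(M,R)$ is achievable if there is (for some $F$) a symmetric scheme with cache size $M$ and rate $R$. The exact rate memory tradeoff is $R^*(M)=\min\{R:(M,R)\text{ is achievable}\}$.
   Formalization: Proved for N ≥ 2 and M at most N(K−1)/K (beyond this the formula violates R ≥ 1 − M/N), with R*(M) taken as an infimum, since no minimum exists for irrational M; for rational M the minimum is shown to be attained. *)

theory Defs
  imports "HOL-Probability.Information" "HOL-Combinatorics.Permutations"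
begin

definition library_space :: "nat \<Rightarrow> nat \<Rightarrow> (nat \<Rightarrow> bool list) set" where
  "library_space N F = {1..N} \<rightarrow>\<^sub>E {w. length w = F}"

text \<open>Drawing the library uniformly from this product makes the files independent and
  uniformly distributed.\<close>

definition H :: "nat \<Rightarrow> nat \<Rightarrow> ((nat \<Rightarrow> bool list) \<Rightarrow> 'a) \<Rightarrow> real" where
  "H N F V = prob_space.entropy (uniform_count_measure (library_space N F)) 2
       (count_space (V ` library_space N F)) V / real F"

definition demands :: "nat \<Rightarrow> nat \<Rightarrow> (nat \<Rightarrow> nat) set" where
  "demands N K = {d \<in> {1..K} \<rightarrow>\<^sub>E {1..N}. d ` {1..K} = {1..N}}"

text \<open>A variable of at most \<open>b\<close> bits is a bit string of some fixed length \<open>l \<le> b\<close>; the length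
  does not depend on the library, so it cannot itself carry information.\<close>

definition at_most_bits :: "nat \<Rightarrow> nat \<Rightarrow> ((nat \<Rightarrow> bool list) \<Rightarrow> bool list) \<Rightarrow> real \<Rightarrow> bool" where
  "at_most_bits N F V b \<longleftrightarrow> (\<exists>l. real l \<le> b \<and> (\<forall>W\<in>library_space N F. length (V W) = l))"

definition caching_scheme :: "nat \<Rightarrow> nat \<Rightarrow> real \<Rightarrow> real \<Rightarrow> nat
    \<Rightarrow> (nat \<Rightarrow> (nat \<Rightarrow> bool list) \<Rightarrow> bool list)
    \<Rightarrow> ((nat \<Rightarrow> nat) \<Rightarrow> (nat \<Rightarrow> bool list) \<Rightarrow> bool list) \<Rightarrow> bool" where
  "caching_scheme N K M R F Z X \<longleftrightarrow>
     0 \<le> M \<and> M \<le> real N \<and> 0 \<le> R \<and> 0 < F \<and>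
     (\<forall>k\<in>{1..K}. at_most_bits N F (Z k) (M * real F)) \<and>
     (\<forall>d\<in>demands N K. at_most_bits N F (X d) (R * real F) \<and>
        (\<forall>k\<in>{1..K}. \<exists>decode. \<forall>W\<in>library_space N F. decode (Z k W) (X d W) = W (d k)))"

text \<open>\<open>permute_demand K \<pi> \<sigma> d\<close> is \<open>\<sigma> \<circ> d \<circ> \<pi>\<^sup>-\<^sup>1\<close>, restricted so that it is again
  an extensional function on \<open>{1..K}\<close>.\<close>

definition permute_demand ::
    "nat \<Rightarrow> (nat \<Rightarrow> nat) \<Rightarrow> (nat \<Rightarrow> nat) \<Rightarrow> (nat \<Rightarrow> nat) \<Rightarrow> nat \<Rightarrow> nat" where
  "permute_demand K \<pi> \<sigma> d = restrict (\<sigma> \<circ> d \<circ> inv \<pi>) {1..K}"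

definition symmetric_scheme :: "nat \<Rightarrow> nat \<Rightarrow> nat
    \<Rightarrow> (nat \<Rightarrow> (nat \<Rightarrow> bool list) \<Rightarrow> bool list)
    \<Rightarrow> ((nat \<Rightarrow> nat) \<Rightarrow> (nat \<Rightarrow> bool list) \<Rightarrow> bool list) \<Rightarrow> bool" where
  "symmetric_scheme N K F Z X \<longleftrightarrow>
     (\<forall>\<pi> \<sigma> A B E. \<pi> permutes {1..K} \<longrightarrow> \<sigma> permutes {1..N} \<longrightarrow>
        A \<subseteq> {1..N} \<longrightarrow> B \<subseteq> {1..K} \<longrightarrow> E \<subseteq> demands N K \<longrightarrow>
        H N F (\<lambda>W. (\<lambda>n\<in>A. W n, \<lambda>k\<in>B. Z k W, \<lambda>d\<in>E. X d W)) =
        H N F (\<lambda>W. (\<lambda>n\<in>A. W (\<sigma> n), \<lambda>k\<in>B. Z (\<pi> k) W,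
                     \<lambda>d\<in>E. X (permute_demand K \<pi> \<sigma> d) W)))"

definition achievable :: "nat \<Rightarrow> nat \<Rightarrow> real \<Rightarrow> real \<Rightarrow> bool" where
  "achievable N K M R \<longleftrightarrow>
     (\<exists>F Z X. caching_scheme N K M R F Z X \<and> symmetric_scheme N K F Z X)"

text \<open>The infimum is not attained in general: if \<open>M\<close> is irrational, a scheme of finite file size
  \<open>F\<close> uses only \<open>\<lfloor>M * F\<rfloor> < M * F\<close> bits of each cache. Hence \<open>Inf\<close> rather than a minimum.\<close>

definition Rstar :: "nat \<Rightarrow> nat \<Rightarrow> real \<Rightarrow> real" where
  "Rstar N K M = Inf {R. achievable N K M R}"

end

theory Submission
  imports Defs
begin

text \<open>Converse. Let \<open>h\<close> denote entropy given \<open>W\<^sub>1, \<dots>, W\<^bsub>N-1\<^esub>\<close>. Take \<open>K\<close> cyclically shifted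
  demands \<open>D 1, \<dots>, D K\<close> such that user \<open>i\<close> requests file \<open>N\<close> in \<open>D i\<close>, and let \<open>a s\<close> be the
  value of \<open>h\<close> on the cache of user \<open>j = K - s\<close> together with the \<open>s\<close> broadcasts \<open>D (j+1), \<dots>, D K\<close>.
  Adding these one user after the other by submodularity, each step decodes \<open>W\<^sub>N\<close> and keeps the
  common broadcasts, so the sum of all \<open>a s\<close> is at least \<open>K - 1\<close>. Conversely a cache and \<open>N - 1\<close>
  broadcasts with all of the requests \<open>1, \<dots>, N-1\<close> give \<open>a s \<le> q := M + (N-1) R - (N-1)\<close> for
  \<open>s < N\<close>; for \<open>s \<ge> N\<close> two such families with union of size \<open>s\<close> and intersection of size
  \<open>2N-2-s\<close> give \<open>a s + a (2N-2-s) \<le> 2q\<close>. Hence \<open>K q \<ge> K - 1\<close>, which is the claimed line.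

  Achievability. The line joins two points: \<open>(N(K-1)/K, 1/K)\<close>, reached by uncoded caching with a
  single broadcast sum, and the left corner, where \<open>R = 1/(K-1)\<close>, reached by a linear scheme over the
  field with four elements. Rational points in between follow by memory sharing, other points by
  approximation, and any scheme can be symmetrized by running it under all relabellings in parallel.\<close>

section \<open>Entropy of functions of a uniform library\<close>

lemma restrict_eq_iff: "restrict f S = restrict g S \<longleftrightarrow> (\<forall>x\<in>S. f x = g x)"
  by (auto simp: restrict_def fun_eq_iff)

lemma finite_bits: "finite {w::bool list. length w = l}"
  and card_bits: "card {w::bool list. length w = l} = 2 ^ l"
proof -
  have e: "{w::bool list. length w = l} = {w. set w \<subseteq> UNIV \<and> length w = l}" by simp
  show "finite {w::bool list. length w = l}"
    unfolding e by (rule finite_lists_length_eq) simp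
  show "card {w::bool list. length w = l} = 2 ^ l"
    unfolding e by (subst card_lists_length_eq) auto
qed

text \<open>Indexed by a point instead of a value: entropies of variables with different types then
  become sums over one common set and can be compared term by term.\<close>

definition fiber_card :: "'a set \<Rightarrow> ('a \<Rightarrow> 'b) \<Rightarrow> 'a \<Rightarrow> nat" where
  "fiber_card L V x = card {y\<in>L. V y = V x}"

lemma fiber_card_pos:
  assumes "finite L" "x \<in> L"
  shows "fiber_card L V x > 0"
  using assms by (auto simp: fiber_card_def card_gt_0_iff)

lemma information_space_uniform:
  assumes "finite L" "L \<noteq> {}"
  shows "information_space (uniform_count_measure L) 2"
proof -
  interpret prob_space "uniform_count_measure L"
    using assms by (rule prob_space_uniform_count_measure)
  show ?thesis by unfold_locales simp
qed

lemma simple_function_uniform: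
  assumes "finite L"
  shows "simple_function (uniform_count_measure L) V"
  using assms by (auto simp: simple_function_def sets_uniform_count_measure space_uniform_count_measure)

text \<open>A value with a fiber of c points has probability c / \<open>card L\<close>, and its term
  in the entropy is split evenly among those c points.\<close>

lemma entropy_uniform_fiber:
  assumes L: "finite L" "L \<noteq> {}"
  shows "prob_space.entropy (uniform_count_measure L) 2 (count_space (V ` L)) V
         = (\<Sum>x\<in>L. log 2 (card L / fiber_card L V x)) / card L"
proof -
  interpret information_space "uniform_count_measure L" 2
    using L by (rule information_space_uniform)
  let ?f = "\<lambda>v. prob (V -` {v} \<inter> L)"
  have sd: "simple_distributed (uniform_count_measure L) V ?f"
    by (rule simple_distributedI[OF simple_function_uniform[OF L(1)]])
       (auto simp: space_uniform_count_measure)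
  have f: "?f v = card {y\<in>L. V y = v} / card L" for v
  proof -
    have "V -` {v} \<inter> L = {y\<in>L. V y = v}" by auto
    then show ?thesis using L by (simp add: measure_uniform_count_measure)
  qed
  have cL: "card L > 0" using L by (simp add: card_gt_0_iff)
  have "entropy 2 (count_space (V ` L)) V = - (\<Sum>v\<in>V`L. ?f v * log 2 (?f v))"
    using entropy_simple_distributed[OF sd] by (simp add: space_uniform_count_measure)
  also have "\<dots> = (\<Sum>v\<in>V`L. \<Sum>x\<in>{y\<in>L. V y = v}. log 2 (card L / fiber_card L V x) / card L)"
    unfolding sum_negf[symmetric]
  proof (rule sum.cong[OF refl])
    fix v assume "v \<in> V ` L"
    then have c: "card {y\<in>L. V y = v} > 0" using L by (auto simp: card_gt_0_iff)
    have "(\<Sum>x\<in>{y\<in>L. V y = v}. log 2 (card L / fiber_card L V x) / card L)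
        = (\<Sum>x\<in>{y\<in>L. V y = v}. log 2 (card L / card {y\<in>L. V y = v}) / card L)"
      by (rule sum.cong) (auto simp: fiber_card_def)
    also have "\<dots> = card {y\<in>L. V y = v} * (log 2 (card L / card {y\<in>L. V y = v}) / card L)"
      by simp
    also have "\<dots> = - (?f v * log 2 (?f v))"
      using c cL by (simp add: f log_divide field_simps)
    finally show "- (?f v * log 2 (?f v)) = (\<Sum>x\<in>{y\<in>L. V y = v}. log 2 (card L / fiber_card L V x) / card L)" ..
  qed
  also have "\<dots> = (\<Sum>x\<in>L. log 2 (card L / fiber_card L V x) / card L)"
    using sum.image_gen[OF L(1), of "\<lambda>x. log 2 (card L / fiber_card L V x) / card L" V] by simp
  finally show ?thesis by (simp add: sum_divide_distrib)
qed

text \<open>Double counting behind the nonnegativity of conditional mutual information, with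
  \<open>V4\<close> as joint variable and \<open>V3\<close> as common part. A pair (y, z)
  contributes only if \<open>V3\<close> agrees on it. The points matching y in \<open>V1\<close> and
  z in \<open>V2\<close> lie in one fiber of \<open>V4\<close>, whose size the weight cancels; the
  remaining weights for fixed y sum to 1 over z.\<close>

lemma fiber_card_submodular:
  fixes V1 :: "'a \<Rightarrow> 'b1" and V2 :: "'a \<Rightarrow> 'b2" and V3 :: "'a \<Rightarrow> 'b3" and V4 :: "'a \<Rightarrow> 'b4"
  assumes L: "finite L"
    and d1: "\<And>x y. x \<in> L \<Longrightarrow> y \<in> L \<Longrightarrow> V1 x = V1 y \<Longrightarrow> V3 x = V3 y"
    and d2: "\<And>x y. x \<in> L \<Longrightarrow> y \<in> L \<Longrightarrow> V2 x = V2 y \<Longrightarrow> V3 x = V3 y"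
    and d4: "\<And>x y. x \<in> L \<Longrightarrow> y \<in> L \<Longrightarrow> V1 x = V1 y \<Longrightarrow> V2 x = V2 y \<Longrightarrow> V4 x = V4 y"
  shows "(\<Sum>x\<in>L. real (fiber_card L V1 x) * real (fiber_card L V2 x)
             / (real (fiber_card L V4 x) * real (fiber_card L V3 x))) \<le> real (card L)"
proof -
  let ?c = "fiber_card L"
  let ?w = "\<lambda>x. 1 / (real (?c V4 x) * real (?c V3 x))"
  have "(\<Sum>x\<in>L. real (?c V1 x) * real (?c V2 x) / (real (?c V4 x) * real (?c V3 x)))
      = (\<Sum>x\<in>L. \<Sum>y\<in>L. \<Sum>z\<in>L. if V1 y = V1 x \<and> V2 z = V2 x then ?w x else 0)"
  proof (rule sum.cong[OF refl])
    fix x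
    have "(\<Sum>y\<in>L. \<Sum>z\<in>L. if V1 y = V1 x \<and> V2 z = V2 x then ?w x else 0)
        = (\<Sum>y\<in>L. if V1 y = V1 x then (\<Sum>z\<in>L. if V2 z = V2 x then ?w x else 0) else 0)"
      by (intro sum.cong) auto
    also have "\<dots> = real (?c V1 x) * (real (?c V2 x) * ?w x)"
      using L by (simp add: sum.If_cases fiber_card_def Int_def)
    finally show "real (?c V1 x) * real (?c V2 x) / (real (?c V4 x) * real (?c V3 x))
      = (\<Sum>y\<in>L. \<Sum>z\<in>L. if V1 y = V1 x \<and> V2 z = V2 x then ?w x else 0)" by simp
  qed
  also have "\<dots> = (\<Sum>y\<in>L. \<Sum>z\<in>L. \<Sum>x\<in>L. if V1 y = V1 x \<and> V2 z = V2 x then ?w x else 0)"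
    by (subst sum.swap, rule sum.cong[OF refl], rule sum.swap)
  also have "\<dots> \<le> (\<Sum>y\<in>L. \<Sum>z\<in>L. if V3 z = V3 y then 1 / real (?c V3 y) else 0)"
  proof (intro sum_mono)
    fix y z assume y: "y \<in> L" and z: "z \<in> L"
    let ?B = "{x\<in>L. V1 y = V1 x \<and> V2 z = V2 x}"
    have eq: "(\<Sum>x\<in>L. if V1 y = V1 x \<and> V2 z = V2 x then ?w x else 0) = (\<Sum>x\<in>?B. ?w x)"
      by (rule sum.inter_filter[OF L, symmetric])
    show "(\<Sum>x\<in>L. if V1 y = V1 x \<and> V2 z = V2 x then ?w x else 0)
        \<le> (if V3 z = V3 y then 1 / real (?c V3 y) else 0)"
    proof (cases "?B = {}")
      case True
      show ?thesis unfolding eq True by simp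
    next
      case False
      then obtain u where u: "u \<in> ?B" by blast
      have v3: "V3 z = V3 y" "V3 u = V3 y" using d1[of y u] d2[of z u] u y z by auto
      have "(\<Sum>x\<in>?B. ?w x) = (\<Sum>x\<in>?B. ?w u)"
      proof (rule sum.cong[OF refl])
        fix x assume x: "x \<in> ?B"
        then have "V1 x = V1 u" "V2 x = V2 u" "x \<in> L" "u \<in> L" using u by simp_all
        then have "V4 x = V4 u" "V3 x = V3 u" using d1[of x u] d4[of x u] by blast+
        then show "?w x = ?w u" by (simp add: fiber_card_def)
      qed
      also have "\<dots> = real (card ?B) * ?w u" by simp
      also have "\<dots> \<le> real (?c V4 u) * ?w u"
      proof (rule mult_right_mono)
        have "x \<in> L \<and> V4 x = V4 u" if x: "x \<in> ?B" for x
        proof -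
          have "V1 x = V1 u" "V2 x = V2 u" "x \<in> L" "u \<in> L" using x u by simp_all
          then show ?thesis using d4[of x u] by blast
        qed
        then have "?B \<subseteq> {x\<in>L. V4 x = V4 u}" by blast
        then show "real (card ?B) \<le> real (?c V4 u)"
          unfolding fiber_card_def of_nat_le_iff by (rule card_mono[rotated]) (use L in auto)
      qed simp
      also have "\<dots> = 1 / real (?c V3 y)"
        using fiber_card_pos[OF L, of u V4] u v3 by (simp add: fiber_card_def)
      finally show ?thesis unfolding eq using v3 by simp
    qed
  qed
  also have "\<dots> = (\<Sum>y\<in>L. 1)"
  proof (rule sum.cong[OF refl])
    fix y assume y: "y \<in> L"
    show "(\<Sum>z\<in>L. if V3 z = V3 y then 1 / real (?c V3 y) else 0) = 1"
      using L y fiber_card_pos[OF L y, of V3]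
      by (auto simp: sum.If_cases fiber_card_def Int_def)
  qed
  finally show ?thesis by simp
qed

section \<open>Normalized entropy of functions of the library\<close>

lemma finite_library: "finite (library_space N F)"
  and library_nonempty: "library_space N F \<noteq> {}"
  and card_library: "card (library_space N F) = 2 ^ (N * F)"
proof -
  show "finite (library_space N F)" unfolding library_space_def by (intro finite_PiE finite_bits) auto
  show cl: "card (library_space N F) = 2 ^ (N * F)"
    unfolding library_space_def
    by (subst card_PiE) (simp_all add: card_bits power_mult[symmetric] mult.commute)
  then show "library_space N F \<noteq> {}" by force
qed

lemma H_eq:
  "H N F V = (\<Sum>x\<in>library_space N F. log 2 (card (library_space N F) / fiber_card (library_space N F) V x))
     / card (library_space N F) / F"
  unfolding H_def by (subst entropy_uniform_fiber[OF finite_library library_nonempty]) simp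

text \<open>The logarithm of each ratio of fiber sizes is at most (ratio - 1) / ln 2, and by
  \<open>fiber_card_submodular\<close> these bounds add up to at most 0.\<close>

lemma H_submodular:
  fixes V1 :: "_ \<Rightarrow> 'b1" and V2 :: "_ \<Rightarrow> 'b2" and V3 :: "_ \<Rightarrow> 'b3" and V4 :: "_ \<Rightarrow> 'b4"
  assumes d1: "\<And>x y. x \<in> library_space N F \<Longrightarrow> y \<in> library_space N F \<Longrightarrow> V1 x = V1 y \<Longrightarrow> V3 x = V3 y"
    and d2: "\<And>x y. x \<in> library_space N F \<Longrightarrow> y \<in> library_space N F \<Longrightarrow> V2 x = V2 y \<Longrightarrow> V3 x = V3 y"
    and d4: "\<And>x y. x \<in> library_space N F \<Longrightarrow> y \<in> library_space N F \<Longrightarrow> V1 x = V1 y \<Longrightarrow> V2 x = V2 y \<Longrightarrow> V4 x = V4 y"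
  shows "H N F V4 + H N F V3 \<le> H N F V1 + H N F V2"
proof -
  let ?L = "library_space N F" and ?c = "\<lambda>x. fiber_card (library_space N F) x"
  note L = finite_library[of N F]
  have "(\<Sum>x\<in>?L. log 2 (card ?L / ?c V4 x)) + (\<Sum>x\<in>?L. log 2 (card ?L / ?c V3 x))
      - (\<Sum>x\<in>?L. log 2 (card ?L / ?c V1 x)) - (\<Sum>x\<in>?L. log 2 (card ?L / ?c V2 x))
     = (\<Sum>x\<in>?L. log 2 (real (?c V1 x) * real (?c V2 x) / (real (?c V4 x) * real (?c V3 x))))"
    unfolding sum.distrib[symmetric] sum_subtractf[symmetric]
  proof (rule sum.cong[OF refl])
    fix x assume x: "x \<in> ?L"
    note p = fiber_card_pos[OF L x]
    have cL: "card ?L > 0" by (simp add: card_library)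
    show "log 2 (card ?L / ?c V4 x) + log 2 (card ?L / ?c V3 x) - log 2 (card ?L / ?c V1 x) - log 2 (card ?L / ?c V2 x)
      = log 2 (real (?c V1 x) * real (?c V2 x) / (real (?c V4 x) * real (?c V3 x)))"
      using p[of V1] p[of V2] p[of V3] p[of V4] cL by (simp add: log_divide log_mult)
  qed
  also have "\<dots> \<le> (\<Sum>x\<in>?L. (real (?c V1 x) * real (?c V2 x) / (real (?c V4 x) * real (?c V3 x)) - 1) / ln 2)"
  proof (rule sum_mono)
    fix x assume x: "x \<in> ?L"
    note p = fiber_card_pos[OF L x]
    have "0 < real (?c V1 x) * real (?c V2 x) / (real (?c V4 x) * real (?c V3 x))"
      using p[of V1] p[of V2] p[of V3] p[of V4] by simp
    then show "log 2 (real (?c V1 x) * real (?c V2 x) / (real (?c V4 x) * real (?c V3 x)))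
       \<le> (real (?c V1 x) * real (?c V2 x) / (real (?c V4 x) * real (?c V3 x)) - 1) / ln 2"
      unfolding log_def by (intro divide_right_mono ln_le_minus_one) auto
  qed
  also have "\<dots> = ((\<Sum>x\<in>?L. real (?c V1 x) * real (?c V2 x) / (real (?c V4 x) * real (?c V3 x))) - card ?L) / ln 2"
    by (simp add: sum_divide_distrib[symmetric] sum_subtractf)
  also have "\<dots> \<le> 0"
  proof (rule divide_nonpos_pos)
    have "(\<Sum>x\<in>?L. real (?c V1 x) * real (?c V2 x) / (real (?c V4 x) * real (?c V3 x))) \<le> card ?L"
      by (rule fiber_card_submodular[OF L]) (rule d1 d2 d4; assumption)+
    then show "(\<Sum>x\<in>?L. real (?c V1 x) * real (?c V2 x) / (real (?c V4 x) * real (?c V3 x))) - card ?L \<le> 0"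
      by linarith
  qed simp
  finally have "(\<Sum>x\<in>?L. log 2 (card ?L / ?c V4 x)) + (\<Sum>x\<in>?L. log 2 (card ?L / ?c V3 x))
     \<le> (\<Sum>x\<in>?L. log 2 (card ?L / ?c V1 x)) + (\<Sum>x\<in>?L. log 2 (card ?L / ?c V2 x))" by simp
  then show ?thesis
    unfolding H_eq add_divide_distrib[symmetric] by (intro divide_right_mono) auto
qed

lemma H_const: "H N F (\<lambda>_. c) = 0"
  by (simp add: H_eq fiber_card_def card_library)

lemma H_mono:
  assumes "\<And>x y. x \<in> library_space N F \<Longrightarrow> y \<in> library_space N F \<Longrightarrow> V1 x = V1 y \<Longrightarrow> V4 x = V4 y"
  shows "H N F V4 \<le> H N F V1"
proof -
  \<comment> \<open>Submodularity with a constant both as second variable and as common part; its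
    entropy cancels.\<close>
  have "H N F V4 + H N F (\<lambda>_. ()) \<le> H N F V1 + H N F (\<lambda>_. ())"
    by (rule H_submodular) (use assms in blast)+
  then show ?thesis by simp
qed

lemma H_subadditive:
  assumes "\<And>x y. x \<in> library_space N F \<Longrightarrow> y \<in> library_space N F \<Longrightarrow> V1 x = V1 y \<Longrightarrow> V2 x = V2 y \<Longrightarrow> V4 x = V4 y"
  shows "H N F V4 \<le> H N F V1 + H N F V2"
proof -
  have "H N F V4 + H N F (\<lambda>_. ()) \<le> H N F V1 + H N F V2"
    by (rule H_submodular) (use assms in blast)+
  then show ?thesis by (simp add: H_const)
qed

lemma H_inj:
  assumes "inj_on V (library_space N F)" "F > 0"
  shows "H N F V = N"
proof -
  have "fiber_card (library_space N F) V x = 1" if "x \<in> library_space N F" for x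
  proof -
    have "{y\<in>library_space N F. V y = V x} = {x}" using assms(1) that by (auto dest: inj_onD)
    then show ?thesis by (simp add: fiber_card_def)
  qed
  then have "H N F V = (\<Sum>x\<in>library_space N F. log 2 (2 ^ (N * F))) / card (library_space N F) / F"
    by (simp add: H_eq card_library)
  also have "\<dots> = real N" using assms(2) by (simp add: card_library)
  finally show ?thesis .
qed

lemma H_bits:
  assumes "\<And>x. x \<in> library_space N F \<Longrightarrow> length (V x :: bool list) = l" "F > 0"
  shows "H N F V \<le> l / F"
proof -
  let ?L = "library_space N F"
  interpret information_space "uniform_count_measure ?L" 2
    by (rule information_space_uniform[OF finite_library library_nonempty])
  have "card (V ` ?L) \<le> 2 ^ l"
    unfolding card_bits[symmetric] by (rule card_mono[OF finite_bits]) (use assms in auto)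
  then have c2: "real (card (V ` ?L)) \<le> 2 ^ l" by (metis of_nat_le_iff of_nat_numeral of_nat_power)
  have "entropy 2 (count_space (V ` ?L)) V \<le> log 2 (card (V ` ?L))"
    using entropy_le_card[OF simple_distributedI[OF simple_function_uniform[OF finite_library] measure_nonneg refl], of V]
    by (simp add: space_uniform_count_measure)
  also have "\<dots> \<le> log 2 (2 ^ l)"
    using c2 library_nonempty[of N F] finite_library[of N F] by (subst log_le_cancel_iff) (auto simp: card_gt_0_iff)
  also have "\<dots> = l" by simp
  finally show ?thesis unfolding H_def using assms(2) by (intro divide_right_mono) auto
qed

text \<open>Entropy depends only on fiber sizes, and a bijection of the library matching two kernels
  preserves these. The values of the two variables may be of different types.\<close>

lemma H_kernel_bij:
  assumes bij: "bij_betw \<Phi> (library_space N F) (library_space N F)"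
    and ker: "\<And>x y. x \<in> library_space N F \<Longrightarrow> y \<in> library_space N F \<Longrightarrow>
        V (\<Phi> x) = V (\<Phi> y) \<longleftrightarrow> V' x = V' y"
  shows "H N F V = H N F V'"
proof -
  let ?L = "library_space N F"
  have "fiber_card ?L V (\<Phi> x) = fiber_card ?L V' x" if x: "x \<in> ?L" for x
  proof -
    have "bij_betw \<Phi> {y\<in>?L. V' y = V' x} {y\<in>?L. V y = V (\<Phi> x)}"
    proof (intro bij_betw_imageI)
      show "inj_on \<Phi> {y\<in>?L. V' y = V' x}"
        using bij by (auto simp: bij_betw_def inj_on_def)
      show "\<Phi> ` {y\<in>?L. V' y = V' x} = {y\<in>?L. V y = V (\<Phi> x)}"
      proof (intro equalityI subsetI)
        fix y assume y: "y \<in> {y\<in>?L. V y = V (\<Phi> x)}"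
        then obtain z where "z \<in> ?L" "y = \<Phi> z" using bij by (auto simp: bij_betw_def)
        then show "y \<in> \<Phi> ` {y\<in>?L. V' y = V' x}" using y ker[OF _ x, of z] by auto
      qed (use bij ker[OF _ x] in \<open>auto simp: bij_betw_def\<close>)
    qed
    then show ?thesis unfolding fiber_card_def by (simp add: bij_betw_same_card)
  qed
  then have "(\<Sum>x\<in>?L. log 2 (card ?L / fiber_card ?L V' x)) = (\<Sum>x\<in>?L. log 2 (card ?L / fiber_card ?L V (\<Phi> x)))"
    by (intro sum.cong) auto
  also have "\<dots> = (\<Sum>x\<in>?L. log 2 (card ?L / fiber_card ?L V x))"
    by (rule sum.reindex_bij_betw[OF bij])
  finally show ?thesis unfolding H_eq by simp
qed

section \<open>The converse bound\<close>

locale symmetric_caching =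
  fixes N K F :: nat and M R :: real
    and Z :: "nat \<Rightarrow> (nat \<Rightarrow> bool list) \<Rightarrow> bool list"
    and X :: "(nat \<Rightarrow> nat) \<Rightarrow> (nat \<Rightarrow> bool list) \<Rightarrow> bool list"
  assumes scheme: "caching_scheme N K M R F Z X"
    and symmetric: "symmetric_scheme N K F Z X"
    and two_le_N: "2 \<le> N" and N_le_K: "N \<le> K" and K_less_2N: "K < 2 * N"
begin

section \<open>Joint entropies of files, caches and broadcasts\<close>

abbreviation L where "L \<equiv> library_space N F"

text \<open>The kernel of the variable whose entropy is \<open>J\<close>. Inequalities between
  values of \<open>J\<close> reduce to saying which coincidences force which others.\<close>

definition agree :: "nat set \<Rightarrow> nat set \<Rightarrow> (nat \<Rightarrow> nat) set \<Rightarrow> (nat \<Rightarrow> bool list) \<Rightarrow> (nat \<Rightarrow> bool list) \<Rightarrow> bool" where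
  "agree A B E x y \<longleftrightarrow> (\<forall>n\<in>A. x n = y n) \<and> (\<forall>k\<in>B. Z k x = Z k y) \<and> (\<forall>d\<in>E. X d x = X d y)"

definition J :: "nat set \<Rightarrow> nat set \<Rightarrow> (nat \<Rightarrow> nat) set \<Rightarrow> real" where
  "J A B E = H N F (\<lambda>W. (\<lambda>n\<in>A. W n, \<lambda>k\<in>B. Z k W, \<lambda>d\<in>E. X d W))"

lemma F_pos: "F > 0"
  using scheme by (simp add: caching_scheme_def)

lemma J_submodular:
  assumes "\<And>x y. x \<in> L \<Longrightarrow> y \<in> L \<Longrightarrow> agree A1 B1 E1 x y \<Longrightarrow> agree A3 B3 E3 x y"
    and "\<And>x y. x \<in> L \<Longrightarrow> y \<in> L \<Longrightarrow> agree A2 B2 E2 x y \<Longrightarrow> agree A3 B3 E3 x y"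
    and "\<And>x y. x \<in> L \<Longrightarrow> y \<in> L \<Longrightarrow> agree A1 B1 E1 x y \<Longrightarrow> agree A2 B2 E2 x y \<Longrightarrow> agree A4 B4 E4 x y"
  shows "J A4 B4 E4 + J A3 B3 E3 \<le> J A1 B1 E1 + J A2 B2 E2"
  unfolding J_def
  by (rule H_submodular; unfold prod.inject restrict_eq_iff agree_def[symmetric]; (rule assms; assumption))

lemma J_mono:
  assumes "\<And>x y. x \<in> L \<Longrightarrow> y \<in> L \<Longrightarrow> agree A1 B1 E1 x y \<Longrightarrow> agree A2 B2 E2 x y"
  shows "J A2 B2 E2 \<le> J A1 B1 E1"
  unfolding J_def
  by (rule H_mono; unfold prod.inject restrict_eq_iff agree_def[symmetric]; (rule assms; assumption))

lemma J_subadditive: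
  assumes "\<And>x y. x \<in> L \<Longrightarrow> y \<in> L \<Longrightarrow> agree A1 B1 E1 x y \<Longrightarrow> agree A2 B2 E2 x y \<Longrightarrow> agree A4 B4 E4 x y"
  shows "J A4 B4 E4 \<le> J A1 B1 E1 + J A2 B2 E2"
  unfolding J_def
  by (rule H_subadditive; unfold prod.inject restrict_eq_iff agree_def[symmetric]; (rule assms; assumption))

lemma agree_subset:
  assumes "agree A B E x y" "A' \<subseteq> A" "B' \<subseteq> B" "E' \<subseteq> E"
  shows "agree A' B' E' x y"
  using assms unfolding agree_def by blast

lemma decode:
  assumes "x \<in> L" "y \<in> L" "d \<in> demands N K" "k \<in> {1..K}" "Z k x = Z k y" "X d x = X d y"
  shows "x (d k) = y (d k)"
proof -
  obtain dec where "\<forall>W\<in>L. dec (Z k W) (X d W) = W (d k)"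
    using scheme assms(3,4) unfolding caching_scheme_def by blast
  then show ?thesis using assms by metis
qed

lemma J_cache: "k \<in> {1..K} \<Longrightarrow> J {} {k} {} \<le> M"
proof -
  assume "k \<in> {1..K}"
  then obtain l where l: "real l \<le> M * F" "\<forall>W\<in>L. length (Z k W) = l"
    using scheme unfolding caching_scheme_def at_most_bits_def by blast
  have "J {} {k} {} \<le> H N F (Z k)"
    unfolding J_def by (rule H_mono) (simp add: restrict_eq_iff)
  also have "\<dots> \<le> l / F" using l F_pos by (intro H_bits) auto
  also have "\<dots> \<le> M" using l F_pos by (simp add: field_simps)
  finally show ?thesis .
qed

lemma J_broadcast: "d \<in> demands N K \<Longrightarrow> J {} {} {d} \<le> R"
proof -
  assume "d \<in> demands N K"
  then obtain l where l: "real l \<le> R * F" "\<forall>W\<in>L. length (X d W) = l"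
    using scheme unfolding caching_scheme_def at_most_bits_def by blast
  have "J {} {} {d} \<le> H N F (X d)"
    unfolding J_def by (rule H_mono) (simp add: restrict_eq_iff)
  also have "\<dots> \<le> l / F" using l F_pos by (intro H_bits) auto
  also have "\<dots> \<le> R" using l F_pos by (simp add: field_simps)
  finally show ?thesis .
qed

lemma J_cache_broadcasts:
  assumes "finite E" "E \<subseteq> demands N K" "k \<in> {1..K}"
  shows "J {} {k} E \<le> M + card E * R"
  using assms
proof (induction E)
  case empty
  then show ?case using J_cache by simp
next
  case (insert d E)
  have "J {} {k} (insert d E) \<le> J {} {k} E + J {} {} {d}"
    by (rule J_subadditive) (auto simp: agree_def)
  then show ?case using insert J_broadcast[of d] by (simp add: algebra_simps)
qed

lemma J_all_files:
  assumes "{1..N} \<subseteq> A"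
  shows "N \<le> J A B E"
proof -
  have "inj_on (\<lambda>W. (\<lambda>n\<in>{1..N}. W n, \<lambda>k\<in>{}. Z k W, \<lambda>d\<in>{}. X d W)) L"
    by (auto intro!: inj_onI simp: library_space_def restrict_eq_iff intro: PiE_ext)
  then have "J {1..N} {} {} = N"
    unfolding J_def using F_pos by (rule H_inj)
  moreover have "J {1..N} {} {} \<le> J A B E"
    by (rule J_mono) (use assms in \<open>auto elim: agree_subset\<close>)
  ultimately show ?thesis by simp
qed

text \<open>All files together have entropy at least N, and file N accounts for at most 1 of
  it.\<close>

lemma J_all_but_one_file: "real N - 1 \<le> J {1..N-1} {} {}"
proof -
  have "J {N} {} {} \<le> H N F (\<lambda>W. W N)"
    unfolding J_def by (rule H_mono) (simp add: restrict_eq_iff)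
  also have "\<dots> \<le> F / F"
    by (rule H_bits) (use F_pos two_le_N in \<open>auto simp: library_space_def PiE_def Pi_def\<close>)
  finally have 1: "J {N} {} {} \<le> 1" using F_pos by simp
  have "{1..N} = insert N {1..N-1}" using two_le_N by auto
  then have "J {1..N} {} {} \<le> J {1..N-1} {} {} + J {N} {} {}"
    by (intro J_subadditive) (auto simp: agree_def)
  then show ?thesis using 1 J_all_files[of "{1..N}" "{}" "{}"] by simp
qed

section \<open>The cyclic family of demands\<close>

text \<open>The reflection in the third branch makes the requests at distances \<open>N, \<dots>, s\<close> repeat those at
  distances \<open>2 * N - 1 - s, \<dots>, N - 1\<close>; this is what \<open>a_pair\<close> needs, and it is
  positive only because \<open>K < 2 * N\<close>.\<close>

definition request :: "nat \<Rightarrow> nat" where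
  "request s = (if s = 0 then N else if s < N then s else 2 * N - 1 - s)"

text \<open>The argument of \<open>request\<close> is i - j modulo K, the cyclic distance from user
  j up to user i. User i is at distance 0 and asks for file N.\<close>

definition D :: "nat \<Rightarrow> nat \<Rightarrow> nat" where
  "D i = (\<lambda>j\<in>{1..K}. request (if j \<le> i then i - j else K + i - j))"

lemma request_range: "s < K \<Longrightarrow> request s \<in> {1..N}"
  using two_le_N N_le_K K_less_2N by (auto simp: request_def)

lemma D_demand:
  assumes "i \<in> {1..K}"
  shows "D i \<in> demands N K"
proof -
  have "D i j \<in> {1..N}" if "j \<in> {1..K}" for j
    using that assms unfolding D_def by (simp only: restrict_apply' request_range split: if_split) (auto intro!: request_range[simplified])
  moreover have "n \<in> D i ` {1..K}" if n: "n \<in> {1..N}" for n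
  proof -
    \<comment> \<open>File N is requested at distance 0 and any other file n at distance n; j below
      is the user at that distance from i.\<close>
    define s where "s = (if n = N then 0 else n)"
    have s: "s < K" "request s = n" using n two_le_N N_le_K by (auto simp: s_def request_def)
    define j where "j = (if s < i then i - s else K + i - s)"
    have "j \<in> {1..K}" "(if j \<le> i then i - j else K + i - j) = s"
      using s(1) assms by (auto simp: j_def)
    then have "D i j = n" using s by (simp add: D_def)
    then show ?thesis using \<open>j \<in> {1..K}\<close> by blast
  qed
  moreover have "D i \<in> extensional {1..K}" by (simp add: D_def)
  ultimately show ?thesis unfolding demands_def by (auto simp: PiE_def)
qed

definition cyc :: "nat \<Rightarrow> nat" where
  "cyc x = (if x \<in> {1..<K} then x + 1 else if x = K then 1 else x)"

definition cyc' :: "nat \<Rightarrow> nat" where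
  "cyc' x = (if x \<in> {2..K} then x - 1 else if x = 1 then K else x)"

lemma cyc_cyc': "cyc (cyc' x) = x" and cyc'_cyc: "cyc' (cyc x) = x"
  using two_le_N N_le_K by (auto simp: cyc_def cyc'_def)

lemma inv_cyc: "inv cyc = cyc'"
  by (rule inv_equality) (simp_all add: cyc_cyc' cyc'_cyc)

lemma cyc_permutes: "cyc permutes {1..K}"
proof (rule bij_imp_permutes)
  show "bij_betw cyc {1..K} {1..K}"
    by (rule bij_betw_byWitness[where f' = cyc'])
       (use cyc_cyc' cyc'_cyc two_le_N N_le_K in \<open>auto simp: cyc_def cyc'_def\<close>)
qed (use two_le_N N_le_K in \<open>auto simp: cyc_def\<close>)

lemma permute_D:
  assumes "i \<in> {1..<K}"
  shows "permute_demand K cyc id (D i) = D (i + 1)"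
  unfolding permute_demand_def inv_cyc
  by (rule ext) (use assms in \<open>auto simp: D_def cyc'_def restrict_def Suc_diff_le\<close>)

section \<open>Entropy of one cache with consecutive broadcasts\<close>

text \<open>Joint rather than conditional entropy: it is larger by N - 1, the entropy of the
  conditioning files, so M + (N - 1) R appears below where the conditional form has q.\<close>

definition S :: "nat \<Rightarrow> nat set \<Rightarrow> real" where
  "S j I = J {1..N-1} {j} (D ` I)"

text \<open>Symmetry for the cyclic shift of the users with the files held fixed. Indices stay below
  K, so nothing wraps around.\<close>

lemma S_shift:
  assumes "j \<in> {1..<K}" "I \<subseteq> {1..<K}"
  shows "S j I = S (j + 1) ((\<lambda>i. i + 1) ` I)"
proof -
  have "D ` I \<subseteq> demands N K" using D_demand assms(2) by (fastforce)
  then have "S j I = H N F (\<lambda>W. (\<lambda>n\<in>{1..N-1}. W (id n), \<lambda>k\<in>{j}. Z (cyc k) W,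
                     \<lambda>d\<in>D ` I. X (permute_demand K cyc id d) W))"
    unfolding S_def J_def
    using symmetric[unfolded symmetric_scheme_def, rule_format, of cyc id "{1..N-1}" "{j}" "D ` I"]
      cyc_permutes permutes_id assms(1) by auto
  also have "\<dots> = J {1..N-1} {cyc j} (permute_demand K cyc id ` D ` I)"
    \<comment> \<open>Both variables list the same broadcasts, once indexed by the demand and once
      by its relabelling, so their kernels coincide.\<close>
    unfolding J_def by (rule H_kernel_bij[where \<Phi> = id]) (auto simp: restrict_eq_iff)
  also have "permute_demand K cyc id ` D ` I = D ` ((\<lambda>i. i + 1) ` I)"
    unfolding image_image using assms(2) by (intro image_cong refl permute_D) auto
  also have "cyc j = j + 1" using assms(1) by (auto simp: cyc_def)
  finally show ?thesis unfolding S_def .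
qed

lemma S_shifts:
  "1 \<le> j \<Longrightarrow> j + c + s \<le> K \<Longrightarrow> S j {j+1..j+s} = S (j + c) {j+c+1..j+c+s}"
proof (induction c)
  case (Suc c)
  have "S (j + c) {j+c+1..j+c+s} = S (j + c + 1) ((\<lambda>i. i + 1) ` {j+c+1..j+c+s})"
    using Suc.prems by (intro S_shift) auto
  also have "(\<lambda>i. i + 1) ` {j+c+1..j+c+s} = {j+c+2..j+c+s+1}"
    using image_add_atLeastAtMost[of 1 "j+c+1" "j+c+s"] by (simp add: add.commute)
  finally show ?case using Suc by (simp add: add.commute add.left_commute)
qed simp

text \<open>User 1 stands for all users: \<open>S_eq_a\<close> moves any user j, with all broadcasts
  after it, to this position.\<close>

definition a :: "nat \<Rightarrow> real" where
  "a s = S 1 {2..s+1}"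

lemma S_eq_a: "j \<in> {1..K} \<Longrightarrow> S j {j+1..K} = a (K - j)"
  using S_shifts[of 1 "j - 1" "K - j"] by (simp add: a_def numeral_2_eq_2)

lemma S_mono: "I \<subseteq> I' \<Longrightarrow> S j I \<le> S j I'"
  unfolding S_def by (rule J_mono) (auto elim!: agree_subset)

lemma request_served:
  assumes "agree {} {1} (D ` I) x y" "x \<in> L" "y \<in> L" "I \<subseteq> {2..K}" "i \<in> I" "request (i - 1) = n"
  shows "x n = y n"
proof -
  have i: "i \<in> {1..K}" and i2: "1 \<le> i" "1 \<le> K" using assms(4,5) by auto
  have "x (D i 1) = y (D i 1)"
  proof (rule decode[OF assms(2,3) D_demand[OF i]])
    show "Z 1 x = Z 1 y" "X (D i) x = X (D i) y" using assms(1,5) by (simp_all add: agree_def)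
  qed (use i2 in simp)
  moreover have "D i 1 = n" using i2 assms(6) by (simp add: D_def)
  ultimately show ?thesis by simp
qed

text \<open>User 1 decodes the files 1, ..., N - 1 from its cache and the broadcasts in I, so
  adjoining these files costs no entropy. The cache and at most N - 1 broadcasts are then bounded by
  their sizes.\<close>

lemma S_le:
  assumes "I \<subseteq> {2..K}" "card I = N - 1" "{1..N-1} \<subseteq> (\<lambda>i. request (i - 1)) ` I" "R \<ge> 0"
  shows "S 1 I \<le> M + (real N - 1) * R"
proof -
  have fin: "finite I" using assms(1) finite_subset by blast
  have "S 1 I \<le> J {} {1} (D ` I)"
    unfolding S_def
  proof (rule J_mono)
    fix x y assume x: "x \<in> L" and y: "y \<in> L" and ag: "agree {} {1} (D ` I) x y"
    have "x n = y n" if n: "n \<in> {1..N-1}" for n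
    proof -
      obtain i where "i \<in> I" "request (i - 1) = n" using subsetD[OF assms(3) n] by blast
      then show ?thesis using request_served[OF ag x y assms(1)] by blast
    qed
    then show "agree {1..N-1} {1} (D ` I) x y" using ag by (simp add: agree_def)
  qed
  also have "\<dots> \<le> M + card (D ` I) * R"
  proof (rule J_cache_broadcasts)
    show "D ` I \<subseteq> demands N K" using assms(1) by (auto intro!: D_demand)
  qed (use fin two_le_N N_le_K in auto)
  also have "\<dots> \<le> M + (real N - 1) * R"
  proof -
    have "real (card (D ` I)) \<le> real N - 1"
      using card_image_le[OF fin, of D] assms(2) two_le_N by linarith
    then show ?thesis using assms(4) by (simp add: mult_right_mono)
  qed
  finally show ?thesis .
qed

lemma R_nonneg: "R \<ge> 0"
  using scheme by (simp add: caching_scheme_def)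

lemma S_first: "S 1 {2..N} \<le> M + (real N - 1) * R"
proof (rule S_le)
  show "{1..N-1} \<subseteq> (\<lambda>i. request (i - 1)) ` {2..N}"
  proof
    fix n assume "n \<in> {1..N-1}"
    then have "n + 1 \<in> {2..N}" "request (n + 1 - 1) = n" using two_le_N by (auto simp: request_def)
    then show "n \<in> (\<lambda>i. request (i - 1)) ` {2..N}" by (metis image_eqI)
  qed
qed (use N_le_K R_nonneg in auto)

lemma a_le: "s < N \<Longrightarrow> a s \<le> M + (real N - 1) * R"
  unfolding a_def by (rule order_trans[OF S_mono S_first]) auto

lemma a_pair:
  assumes "N \<le> s" "s < K"
  shows "a s + a (2 * N - 2 - s) \<le> 2 * (M + (real N - 1) * R)"
proof -
  define t where "t = 2 * N - 2 - s"
  have t: "t + s = 2 * N - 2" "t + 2 \<le> N" using assms K_less_2N by (auto simp: t_def)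
  \<comment> \<open>I meets {2..N} in {2..t+1} and together with it covers {2..s+1}. User 1 obtains
    the files 1, ..., t through the first interval and, by the reflection in \<open>request\<close>,
    the files t+1, ..., N-1 through the second.\<close>
  define I where "I = {2..t+1} \<union> {N+1..s+1}"
  have "S 1 I \<le> M + (real N - 1) * R"
  proof (rule S_le)
    show "I \<subseteq> {2..K}" using t assms two_le_N by (auto simp: I_def)
    have "card I = card {2..t+1} + card {N+1..s+1}"
      unfolding I_def using t by (intro card_Un_disjoint) auto
    then show "card I = N - 1" using t assms by simp
    show "{1..N-1} \<subseteq> (\<lambda>i. request (i - 1)) ` I"
    proof
      fix n assume n: "n \<in> {1..N-1}"
      define i where "i = (if n \<le> t then n + 1 else 2 * N - n)"
      have "i \<in> I" "request (i - 1) = n" using n t assms by (auto simp: i_def I_def request_def)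
      then show "n \<in> (\<lambda>i. request (i - 1)) ` I" by (metis image_eqI)
    qed
  qed (rule R_nonneg)
  moreover have "S 1 {2..s+1} + S 1 {2..t+1} \<le> S 1 {2..N} + S 1 I"
    unfolding S_def
  proof (rule J_submodular)
    show "agree {1..N-1} {1} (D ` {2..t+1}) x y" if "agree {1..N-1} {1} (D ` {2..N}) x y" for x y
      using that by (rule agree_subset) (use t in auto)
    show "agree {1..N-1} {1} (D ` {2..t+1}) x y" if "agree {1..N-1} {1} (D ` I) x y" for x y
      using that by (rule agree_subset) (auto simp: I_def)
    show "agree {1..N-1} {1} (D ` {2..s+1}) x y"
      if "agree {1..N-1} {1} (D ` {2..N}) x y" "agree {1..N-1} {1} (D ` I) x y" for x y
    proof -
      have "X (D i) x = X (D i) y" if "i \<in> {2..s+1}" for i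
      proof (cases "i \<le> N")
        case True
        then show ?thesis using that \<open>agree {1..N-1} {1} (D ` {2..N}) x y\<close> by (auto simp: agree_def)
      next
        case False
        then have "i \<in> I" using that by (simp add: I_def)
        then show ?thesis using \<open>agree {1..N-1} {1} (D ` I) x y\<close> by (auto simp: agree_def)
      qed
      then show ?thesis using that by (simp add: agree_def)
    qed
  qed
  ultimately show ?thesis using S_first unfolding a_def t_def[symmetric] mult_2[of "M + _"] by (meson add_mono order_trans)
qed

text \<open>The reflection of s to 2N - 2 - s fixes N - 1 and pairs the indices around it. Pairs are
  bounded by \<open>a_pair\<close>, the fixed point and the small unpaired indices by
  \<open>a_le\<close>.\<close>

lemma sum_a_upper: "(\<Sum>s<K. a s) \<le> K * (M + (real N - 1) * R)"
proof -
  let ?q = "M + (real N - 1) * R"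
  \<comment> \<open>A window of 2n - 2N + 1 indices symmetric about N - 1; raising n by one adds the
    pair n, 2N - 2 - n.\<close>
  have mid: "n \<le> K \<Longrightarrow> (\<Sum>s\<in>{2*N-1-n..<n}. a s) \<le> (2 * real n - 2 * real N + 1) * ?q" if "N \<le> n" for n
    using that
  proof (induction n rule: dec_induct)
    case base
    have "{2*N-1-N..<N} = {N-1}" using two_le_N by auto
    then show ?case using a_le[of "N-1"] two_le_N by simp
  next
    case (step n)
    have "{2*N-1-Suc n..<Suc n} = insert n (insert (2*N-2-n) {2*N-1-n..<n})"
      using step K_less_2N by auto
    then have "(\<Sum>s\<in>{2*N-1-Suc n..<Suc n}. a s) = a n + a (2*N-2-n) + (\<Sum>s\<in>{2*N-1-n..<n}. a s)"
      using step K_less_2N by (subst \<open>_ = insert _ _\<close>, subst sum.insert, simp, force, subst sum.insert) auto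
    then show ?case using step a_pair[of n] by (simp add: algebra_simps)
  qed
  have "{..<K} = {..<2*N-1-K} \<union> {2*N-1-K..<K}" using N_le_K by auto
  then have "(\<Sum>s<K. a s) = (\<Sum>s<2*N-1-K. a s) + (\<Sum>s\<in>{2*N-1-K..<K}. a s)"
    by (simp add: sum.union_disjoint ivl_disj_int)
  also have "(\<Sum>s<2*N-1-K. a s) \<le> (\<Sum>s<2*N-1-K. ?q)"
    using N_le_K two_le_N by (intro sum_mono a_le) auto
  also have "(\<Sum>s<2*N-1-K. ?q) = (2 * real N - 1 - real K) * ?q"
    using K_less_2N by (simp add: of_nat_diff)
  also have "(\<Sum>s\<in>{2*N-1-K..<K}. a s) \<le> (2 * real K - 2 * real N + 1) * ?q"
    using mid[of K] N_le_K by simp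
  finally show ?thesis by (simp add: algebra_simps)
qed

section \<open>Adding the users one after the other\<close>

text \<open>In each step the retained broadcast \<open>D (m+1)\<close> and the cache of user m + 1
  reveal file N, so the union has entropy at least N. The first N - 1 files and the later broadcasts
  are common to both sides and are carried on.\<close>

lemma chain:
  assumes "1 \<le> m" "m \<le> K"
  shows "(real m - 1) * N + J {1..N-1} {} (D ` {m+1..K}) \<le> (\<Sum>j=1..m. S j {j+1..K})"
  using assms
proof (induction m rule: dec_induct)
  case base
  have "J {1..N-1} {} (D ` {1+1..K}) \<le> S 1 {1+1..K}"
    unfolding S_def by (rule J_mono) (auto elim!: agree_subset)
  then show ?case by simp
next
  case (step m)
  have "J {1..N} {} {} + J {1..N-1} {} (D ` {Suc m+1..K})
      \<le> J {1..N-1} {} (D ` {m+1..K}) + S (Suc m) {Suc m+1..K}"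
    unfolding S_def
  proof (rule J_submodular)
    fix x y assume x: "x \<in> L" and y: "y \<in> L"
      and 1: "agree {1..N-1} {} (D ` {m+1..K}) x y"
      and 2: "agree {1..N-1} {Suc m} (D ` {Suc m+1..K}) x y"
    have i: "Suc m \<in> {1..K}" using step by simp
    have "x (D (Suc m) (Suc m)) = y (D (Suc m) (Suc m))"
      using 1 2 i by (intro decode[OF x y D_demand[OF i]]) (auto simp: agree_def)
    moreover have "D (Suc m) (Suc m) = N" using i by (simp add: D_def request_def)
    ultimately have "x N = y N" by simp
    moreover have "{1..N} = insert N {1..N-1}" using two_le_N by auto
    ultimately show "agree {1..N} {} {} x y" using 1 by (simp add: agree_def)
  qed (auto elim!: agree_subset)
  then show ?case using step J_all_files[of "{1..N}" "{}" "{}"] by (simp add: algebra_simps)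
qed

theorem tradeoff_lower_bound:
  "real K * real N - 1 \<le> K * (M + (real N - 1) * R)"
proof -
  \<comment> \<open>At m = K no broadcast remains, and the leftover term is the entropy of the first
    N - 1 files.\<close>
  have "(real K - 1) * N + J {1..N-1} {} (D ` {K+1..K}) \<le> (\<Sum>j=1..K. S j {j+1..K})"
    using two_le_N N_le_K by (intro chain) auto
  then have "(real K - 1) * N + (real N - 1) \<le> (\<Sum>j=1..K. S j {j+1..K})"
    using J_all_but_one_file by simp
  also have "\<dots> = (\<Sum>j=1..K. a (K - j))" by (intro sum.cong S_eq_a) auto
  also have "\<dots> = (\<Sum>s<K. a s)"
    by (rule sum.reindex_bij_witness[where i = "\<lambda>s. K - s" and j = "\<lambda>j. K - j"]) auto
  also note sum_a_upper
  finally show ?thesis by (simp add: algebra_simps)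
qed

end

section \<open>Combining and symmetrizing schemes\<close>

definition plain_scheme :: "nat \<Rightarrow> nat \<Rightarrow> nat \<Rightarrow> nat \<Rightarrow> nat \<Rightarrow> bool" where
  "plain_scheme N K F l r \<longleftrightarrow> (\<exists>(Z :: nat \<Rightarrow> (nat \<Rightarrow> bool list) \<Rightarrow> bool list)
       (X :: (nat \<Rightarrow> nat) \<Rightarrow> (nat \<Rightarrow> bool list) \<Rightarrow> bool list).
     (\<forall>k\<in>{1..K}. \<forall>W\<in>library_space N F. length (Z k W) = l) \<and>
     (\<forall>d\<in>demands N K. \<forall>W\<in>library_space N F. length (X d W) = r) \<and>
     (\<forall>d\<in>demands N K. \<forall>k\<in>{1..K}. \<forall>x\<in>library_space N F. \<forall>y\<in>library_space N F.
        Z k x = Z k y \<longrightarrow> X d x = X d y \<longrightarrow> x (d k) = y (d k)))"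

lemma inj_into_bits:
  assumes "finite A" "card A \<le> 2 ^ l"
  obtains e :: "'a \<Rightarrow> bool list" where "inj_on e A" "\<And>a. a \<in> A \<Longrightarrow> length (e a) = l"
proof -
  obtain e :: "'a \<Rightarrow> bool list" where "e ` A \<subseteq> {w. length w = l}" "inj_on e A"
    using card_le_inj[OF assms(1) finite_bits[of l]] assms(2) by (auto simp: card_bits)
  then show ?thesis by (intro that[of e]) auto
qed

text \<open>Frees the constructions from bits: files may come from any set of 2^F elements, and for
  caches and broadcasts only the number of values counts, since an injection encodes them.\<close>

lemma plain_scheme_of_alphabet:
  fixes Z :: "nat \<Rightarrow> (nat \<Rightarrow> 'p) \<Rightarrow> 'z" and X :: "(nat \<Rightarrow> nat) \<Rightarrow> (nat \<Rightarrow> 'p) \<Rightarrow> 'x"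
  assumes P: "finite P" "card P = 2 ^ F"
    and Z: "\<And>k. k \<in> {1..K} \<Longrightarrow> card (Z k ` ({1..N} \<rightarrow>\<^sub>E P)) \<le> 2 ^ l"
    and X: "\<And>d. d \<in> demands N K \<Longrightarrow> card (X d ` ({1..N} \<rightarrow>\<^sub>E P)) \<le> 2 ^ r"
    and dec: "\<And>d k x y. d \<in> demands N K \<Longrightarrow> k \<in> {1..K} \<Longrightarrow> x \<in> {1..N} \<rightarrow>\<^sub>E P \<Longrightarrow> y \<in> {1..N} \<rightarrow>\<^sub>E P \<Longrightarrow>
        Z k x = Z k y \<Longrightarrow> X d x = X d y \<Longrightarrow> x (d k) = y (d k)"
  shows "plain_scheme N K F l r"
proof -
  let ?P = "{1..N} \<rightarrow>\<^sub>E P" and ?L = "library_space N F"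
  have fP: "finite ?P" using P by (intro finite_PiE) auto
  obtain b where b: "bij_betw b {w::bool list. length w = F} P"
    using finite_same_card_bij[OF finite_bits P(1)] P(2) card_bits by metis
  define T where "T W = (\<lambda>n\<in>{1..N}. b (W n))" for W :: "nat \<Rightarrow> bool list"
  have T: "T W \<in> ?P" if "W \<in> ?L" for W
    using that b unfolding T_def library_space_def bij_betw_def by fastforce
  have "\<forall>k\<in>{1..K}. \<exists>e::'z \<Rightarrow> bool list. inj_on e (Z k ` ?P) \<and> (\<forall>a\<in>Z k ` ?P. length (e a) = l)"
    using inj_into_bits[OF finite_imageI[OF fP] Z] by metis
  then obtain eZ :: "nat \<Rightarrow> 'z \<Rightarrow> bool list"
    where eZ: "\<And>k. k \<in> {1..K} \<Longrightarrow> inj_on (eZ k) (Z k ` ?P)"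
      "\<And>k a. k \<in> {1..K} \<Longrightarrow> a \<in> Z k ` ?P \<Longrightarrow> length (eZ k a) = l" by metis
  have "\<forall>d\<in>demands N K. \<exists>e::'x \<Rightarrow> bool list. inj_on e (X d ` ?P) \<and> (\<forall>a\<in>X d ` ?P. length (e a) = r)"
    using inj_into_bits[OF finite_imageI[OF fP] X] by metis
  then obtain eX :: "(nat \<Rightarrow> nat) \<Rightarrow> 'x \<Rightarrow> bool list"
    where eX: "\<And>d. d \<in> demands N K \<Longrightarrow> inj_on (eX d) (X d ` ?P)"
      "\<And>d a. d \<in> demands N K \<Longrightarrow> a \<in> X d ` ?P \<Longrightarrow> length (eX d a) = r" by metis
  show ?thesis
    unfolding plain_scheme_def
  proof (intro exI[of _ "\<lambda>k W. eZ k (Z k (T W))"] exI[of _ "\<lambda>d W. eX d (X d (T W))"] conjI ballI impI)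
    fix d k x y
    assume d: "d \<in> demands N K" and k: "k \<in> {1..K}" and x: "x \<in> ?L" and y: "y \<in> ?L"
      and ez: "eZ k (Z k (T x)) = eZ k (Z k (T y))" and ex: "eX d (X d (T x)) = eX d (X d (T y))"
    have "Z k (T x) = Z k (T y)" using inj_onD[OF eZ(1)[OF k] ez] T x y by blast
    moreover have "X d (T x) = X d (T y)" using inj_onD[OF eX(1)[OF d] ex] T x y by blast
    ultimately have "T x (d k) = T y (d k)" using dec[OF d k T[OF x] T[OF y]] by blast
    moreover have dk: "d k \<in> {1..N}" using d k unfolding demands_def by blast
    ultimately have "b (x (d k)) = b (y (d k))" by (simp add: T_def)
    moreover have "length (x (d k)) = F" "length (y (d k)) = F"
      using x y dk unfolding library_space_def by blast+
    ultimately show "x (d k) = y (d k)" using b unfolding bij_betw_def inj_on_def by blast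
  qed (use eZ(2) eX(2) T in auto)
qed

text \<open>Memory sharing: one scheme serves the first F1 bits of every file, the other the
  remaining F2.\<close>

lemma plain_scheme_add:
  assumes "plain_scheme N K F1 l1 r1" "plain_scheme N K F2 l2 r2"
  shows "plain_scheme N K (F1 + F2) (l1 + l2) (r1 + r2)"
proof -
  let ?L1 = "library_space N F1" and ?L2 = "library_space N F2" and ?L = "library_space N (F1 + F2)"
  obtain Z1 X1 where s1: "\<forall>k\<in>{1..K}. \<forall>W\<in>?L1. length (Z1 k W :: bool list) = l1"
      "\<forall>d\<in>demands N K. \<forall>W\<in>?L1. length (X1 d W :: bool list) = r1"
    and dec1: "\<And>d k x y. d \<in> demands N K \<Longrightarrow> k \<in> {1..K} \<Longrightarrow> x \<in> ?L1 \<Longrightarrow> y \<in> ?L1 \<Longrightarrow>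
        Z1 k x = Z1 k y \<Longrightarrow> X1 d x = X1 d y \<Longrightarrow> x (d k) = y (d k)"
    using assms(1) unfolding plain_scheme_def by blast
  obtain Z2 X2 where s2: "\<forall>k\<in>{1..K}. \<forall>W\<in>?L2. length (Z2 k W :: bool list) = l2"
      "\<forall>d\<in>demands N K. \<forall>W\<in>?L2. length (X2 d W :: bool list) = r2"
    and dec2: "\<And>d k x y. d \<in> demands N K \<Longrightarrow> k \<in> {1..K} \<Longrightarrow> x \<in> ?L2 \<Longrightarrow> y \<in> ?L2 \<Longrightarrow>
        Z2 k x = Z2 k y \<Longrightarrow> X2 d x = X2 d y \<Longrightarrow> x (d k) = y (d k)"
    using assms(2) unfolding plain_scheme_def by blast
  define A where "A W = (\<lambda>n\<in>{1..N}. take F1 (W n))" for W :: "nat \<Rightarrow> bool list"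
  define B where "B W = (\<lambda>n\<in>{1..N}. drop F1 (W n))" for W :: "nat \<Rightarrow> bool list"
  have A: "A W \<in> ?L1" and B: "B W \<in> ?L2" if "W \<in> ?L" for W
    using that by (auto simp: library_space_def A_def B_def PiE_def Pi_def)
  show ?thesis
    unfolding plain_scheme_def
  proof (intro exI[of _ "\<lambda>k W. Z1 k (A W) @ Z2 k (B W)"] exI[of _ "\<lambda>d W. X1 d (A W) @ X2 d (B W)"] conjI ballI impI)
    fix d k x y
    assume d: "d \<in> demands N K" and k: "k \<in> {1..K}" and x: "x \<in> ?L" and y: "y \<in> ?L"
      and ez: "Z1 k (A x) @ Z2 k (B x) = Z1 k (A y) @ Z2 k (B y)"
      and ex: "X1 d (A x) @ X2 d (B x) = X1 d (A y) @ X2 d (B y)"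
    have "length (Z1 k (A x)) = length (Z1 k (A y))" "length (X1 d (A x)) = length (X1 d (A y))"
      using s1 d k A[OF x] A[OF y] by simp_all
    then have "Z1 k (A x) = Z1 k (A y)" "Z2 k (B x) = Z2 k (B y)" "X1 d (A x) = X1 d (A y)" "X2 d (B x) = X2 d (B y)"
      using ez ex by simp_all
    then have "A x (d k) = A y (d k)" "B x (d k) = B y (d k)"
      using dec1[OF d k A[OF x] A[OF y]] dec2[OF d k B[OF x] B[OF y]] by blast+
    moreover have "d k \<in> {1..N}" using d k unfolding demands_def by blast
    ultimately show "x (d k) = y (d k)"
      unfolding A_def B_def by (metis append_take_drop_id restrict_apply')
  qed (use s1 s2 A B in auto)
qed

lemma plain_scheme_copies:
  assumes "plain_scheme N K F l r"
  shows "plain_scheme N K (c * F) (c * l) (c * r)"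
proof (induction c)
  case 0
  have "x n = y n" if "x \<in> library_space N 0" "y \<in> library_space N 0" "n \<in> {1..N}" for x y n
    using that by (auto simp: library_space_def PiE_def Pi_def)
  moreover have "d k \<in> {1..N}" if "d \<in> demands N K" "k \<in> {1..K}" for d k
    using that unfolding demands_def by blast
  ultimately show ?case
    unfolding plain_scheme_def by (intro exI[of _ "\<lambda>_ _. []"]) auto
next
  case (Suc c)
  then show ?case using plain_scheme_add[OF assms Suc.IH] by simp
qed

section \<open>Cutting files into blocks\<close>

definition block :: "nat \<Rightarrow> nat \<Rightarrow> 'a list \<Rightarrow> 'a list" where
  "block F i w = take F (drop (i * F) w)"

abbreviation tabulate :: "nat \<Rightarrow> (nat \<Rightarrow> 'a list) \<Rightarrow> 'a list" where
  "tabulate c f \<equiv> concat (map f [0..<c])"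

lemma length_tabulate: "(\<And>i. i < c \<Longrightarrow> length (f i) = F) \<Longrightarrow> length (tabulate c f) = c * F"
  by (induction c) auto

lemma length_block: "length w = c * F \<Longrightarrow> i < c \<Longrightarrow> length (block F i w) = F"
proof -
  assume w: "length w = c * F" and i: "i < c"
  have "Suc i * F \<le> c * F" using i by (intro mult_right_mono) auto
  then show ?thesis using w by (simp add: block_def)
qed

lemma block_tabulate:
  "(\<And>i. i < c \<Longrightarrow> length (f i) = F) \<Longrightarrow> j < c \<Longrightarrow> block F j (tabulate c f) = f j"
proof (induction c)
  case (Suc c)
  have l: "length (tabulate c f) = c * F" using Suc by (intro length_tabulate) auto
  show ?case
  proof (cases "j = c")
    case True
    then show ?thesis using l Suc.prems by (simp add: block_def)
  next
    case False
    then have "j < c" using Suc by simp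
    then have "Suc j * F \<le> c * F" by (intro mult_right_mono) auto
    then have "block F j (tabulate (Suc c) f) = block F j (tabulate c f)"
      using l by (simp add: block_def)
    then show ?thesis using Suc \<open>j < c\<close> by simp
  qed
qed simp

lemma tabulate_block: "length w = c * F \<Longrightarrow> tabulate c (\<lambda>i. block F i w) = w"
proof (induction c arbitrary: w)
  case (Suc c)
  let ?w = "take (c * F) w"
  have "block F i w = block F i ?w" if "i < c" for i
  proof -
    have "Suc i * F \<le> c * F" using that by (intro mult_right_mono) auto
    then show ?thesis by (simp add: block_def drop_take min_def)
  qed
  then have "tabulate c (\<lambda>i. block F i w) = tabulate c (\<lambda>i. block F i ?w)"
    by (intro arg_cong[where f = concat] map_cong) auto
  also have "\<dots> = ?w" using Suc by simp
  finally show ?case using Suc.prems by (simp add: block_def)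
qed simp

lemma tabulate_eq_iff:
  assumes "\<And>i. i < c \<Longrightarrow> length (f i) = F" "\<And>i. i < c \<Longrightarrow> length (g i) = F"
  shows "tabulate c f = tabulate c g \<longleftrightarrow> (\<forall>i<c. f i = g i)"
proof
  assume e: "tabulate c f = tabulate c g"
  show "\<forall>i<c. f i = g i"
    using block_tabulate[of c f F] block_tabulate[of c g F] assms e by metis
next
  assume "\<forall>i<c. f i = g i"
  then show "tabulate c f = tabulate c g" by (intro arg_cong[where f = concat] map_cong) auto
qed

lemma block_ext:
  assumes "length w = c * F" "length w' = c * F" "\<And>i. i < c \<Longrightarrow> block F i w = block F i w'"
  shows "w = w'"
proof -
  have "tabulate c (\<lambda>i. block F i w) = tabulate c (\<lambda>i. block F i w')"
    using assms(3) by (intro arg_cong[where f = concat] map_cong) auto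
  then show ?thesis using assms by (simp add: tabulate_block)
qed

section \<open>Relabelling users and files in a demand\<close>

lemma permute_demand_in:
  assumes "\<alpha> permutes {1..K}" "\<beta> permutes {1..N}" "d \<in> demands N K"
  shows "permute_demand K \<alpha> \<beta> d \<in> demands N K"
proof -
  have "permute_demand K \<alpha> \<beta> d ` {1..K} = \<beta> ` d ` inv \<alpha> ` {1..K}"
    by (simp add: permute_demand_def image_comp)
  also have "\<dots> = {1..N}"
    using assms permutes_image[OF assms(2)] permutes_image[OF permutes_inv[OF assms(1)]]
    by (simp add: demands_def)
  finally have im: "permute_demand K \<alpha> \<beta> d ` {1..K} = {1..N}" .
  then have "permute_demand K \<alpha> \<beta> d \<in> {1..K} \<rightarrow> {1..N}" by blast
  then show ?thesis using im by (simp add: demands_def PiE_def permute_demand_def)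
qed

lemma permute_demand_apply:
  assumes "\<alpha> permutes {1..K}" "k \<in> {1..K}"
  shows "permute_demand K \<alpha> \<beta> d (\<alpha> k) = \<beta> (d k)"
proof -
  have "\<alpha> k \<in> {1..K}" using permutes_in_image[OF assms(1)] assms(2) by blast
  then show ?thesis
    by (simp add: permute_demand_def permutes_inverses[OF assms(1)] del: atLeastAtMost_iff)
qed

text \<open>Pairs of permutations act on demands. In this instance the block (\<alpha> \<circ> inv
  \<pi>, \<beta> \<circ> inv \<sigma>) treats the relabelled demand exactly as the block (\<alpha>,
  \<beta>) treats d.\<close>

lemma permute_demand_comp:
  assumes "\<alpha> permutes {1..K}" "\<pi> permutes {1..K}" "\<sigma> permutes {1..N}"
  shows "permute_demand K (\<alpha> \<circ> inv \<pi>) (\<beta> \<circ> inv \<sigma>) (permute_demand K \<pi> \<sigma> d) = permute_demand K \<alpha> \<beta> d"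
proof -
  have "inv (\<alpha> \<circ> inv \<pi>) = \<pi> \<circ> inv \<alpha>"
    using assms by (simp add: o_inv_distrib permutes_bij bij_imp_bij_inv inv_inv_eq)
  moreover have "inv \<alpha> j \<in> {1..K} \<Longrightarrow> \<pi> (inv \<alpha> j) \<in> {1..K}" for j
    using permutes_in_image[OF assms(2)] by blast
  moreover have "j \<in> {1..K} \<Longrightarrow> inv \<alpha> j \<in> {1..K}" for j
    using permutes_in_image[OF permutes_inv[OF assms(1)]] by blast
  ultimately show ?thesis
    using assms(2,3) by (auto simp: permute_demand_def restrict_def fun_eq_iff permutes_inverses)
qed

text \<open>Cut every file into one block for each pair \<open>(\<alpha>, \<beta>)\<close> of permutations, and run in that
  block the given scheme with user \<open>k\<close> in the role of \<open>\<alpha> k\<close> and file \<open>n\<close> in the role of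
  \<open>\<beta> n\<close>. Relabelling users and files then only permutes the blocks, which is a bijection of the
  library.\<close>

lemma symmetrization:
  assumes "plain_scheme N K F l r"
  obtains c Z X where "c > 0" "symmetric_scheme N K (c * F) Z X"
    and "\<And>k W. k \<in> {1..K} \<Longrightarrow> W \<in> library_space N (c * F) \<Longrightarrow> length (Z k W) = c * l"
    and "\<And>d W. d \<in> demands N K \<Longrightarrow> W \<in> library_space N (c * F) \<Longrightarrow> length (X d W) = c * r"
    and "\<And>d k x y. d \<in> demands N K \<Longrightarrow> k \<in> {1..K} \<Longrightarrow> x \<in> library_space N (c * F) \<Longrightarrow>
        y \<in> library_space N (c * F) \<Longrightarrow> Z k x = Z k y \<Longrightarrow> X d x = X d y \<Longrightarrow> x (d k) = y (d k)"
proof -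
  let ?Lib = "library_space N F"
  obtain Z0 X0 where Z0: "\<And>k W. k \<in> {1..K} \<Longrightarrow> W \<in> ?Lib \<Longrightarrow> length (Z0 k W :: bool list) = l"
    and X0: "\<And>d W. d \<in> demands N K \<Longrightarrow> W \<in> ?Lib \<Longrightarrow> length (X0 d W :: bool list) = r"
    and dec0: "\<And>d k x y. d \<in> demands N K \<Longrightarrow> k \<in> {1..K} \<Longrightarrow> x \<in> ?Lib \<Longrightarrow> y \<in> ?Lib \<Longrightarrow>
        Z0 k x = Z0 k y \<Longrightarrow> X0 d x = X0 d y \<Longrightarrow> x (d k) = y (d k)"
    using assms unfolding plain_scheme_def by blast
  define Q where "Q = {\<alpha>. \<alpha> permutes {1..K}} \<times> {\<beta>. \<beta> permutes {1..N}}"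
  have "finite Q" unfolding Q_def by (intro finite_cartesian_product finite_permutations) auto
  then obtain ps where ps: "set ps = Q" "distinct ps" using finite_distinct_list by blast
  define c where "c = length ps"
  define \<alpha> where "\<alpha> i = fst (ps ! i)" for i
  define \<beta> where "\<beta> i = snd (ps ! i)" for i
  have perm: "\<alpha> i permutes {1..K}" "\<beta> i permutes {1..N}" if "i < c" for i
  proof -
    have "ps ! i \<in> Q" using that ps(1) nth_mem unfolding c_def by blast
    then show "\<alpha> i permutes {1..K}" "\<beta> i permutes {1..N}"
      by (simp_all add: Q_def \<alpha>_def \<beta>_def mem_Times_iff)
  qed
  have "(id, id) \<in> Q" by (simp add: Q_def permutes_id)
  then have c: "c > 0" using ps unfolding c_def by auto
  let ?L = "library_space N (c * F)"
  \<comment> \<open>The input of the given scheme in block i: its file m is block i of the file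
    playing the role m.\<close>
  define role where "role i W = (\<lambda>m\<in>{1..N}. block F i (W (inv (\<beta> i) m)))"
    for i and W :: "nat \<Rightarrow> bool list"
  define Z where "Z k W = tabulate c (\<lambda>i. Z0 (\<alpha> i k) (role i W))" for k W
  define X where "X d W = tabulate c (\<lambda>i. X0 (permute_demand K (\<alpha> i) (\<beta> i) d) (role i W))" for d W
  have len: "length (W n) = c * F" if "W \<in> ?L" "n \<in> {1..N}" for W n
    using that unfolding library_space_def by blast
  have role: "role i W \<in> ?Lib" if "W \<in> ?L" "i < c" for i W
  proof -
    have "length (block F i (W (inv (\<beta> i) m))) = F" if m: "m \<in> {1..N}" for m
    proof (rule length_block[OF len[OF \<open>W \<in> ?L\<close>] \<open>i < c\<close>])
      show "inv (\<beta> i) m \<in> {1..N}"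
        using permutes_in_image[OF permutes_inv[OF perm(2)[OF \<open>i < c\<close>]]] m by blast
    qed
    then show ?thesis unfolding library_space_def role_def by auto
  qed
  have user: "\<alpha> i k \<in> {1..K}" if "i < c" "k \<in> {1..K}" for i k
    using permutes_in_image[OF perm(1)[OF that(1)]] that(2) by blast
  have lenZ: "length (Z0 (\<alpha> i k) (role i W)) = l" if "i < c" "k \<in> {1..K}" "W \<in> ?L" for i k W
    using Z0[OF user role] that by blast
  have lenX: "length (X0 (permute_demand K (\<alpha> i) (\<beta> i) d) (role i W)) = r"
    if "i < c" "d \<in> demands N K" "W \<in> ?L" for i d W
    using X0[OF permute_demand_in role] perm that by blast
  have Z_eq: "Z k x = Z k y \<longleftrightarrow> (\<forall>i<c. Z0 (\<alpha> i k) (role i x) = Z0 (\<alpha> i k) (role i y))"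
    if "k \<in> {1..K}" "x \<in> ?L" "y \<in> ?L" for k x y
    unfolding Z_def by (rule tabulate_eq_iff) (use lenZ that in blast)+
  have X_eq: "X d x = X d y \<longleftrightarrow> (\<forall>i<c. X0 (permute_demand K (\<alpha> i) (\<beta> i) d) (role i x)
      = X0 (permute_demand K (\<alpha> i) (\<beta> i) d) (role i y))"
    if "d \<in> demands N K" "x \<in> ?L" "y \<in> ?L" for d x y
    unfolding X_def by (rule tabulate_eq_iff) (use lenX that in blast)+
  show ?thesis
  proof (rule that[OF c])
    show "length (Z k W) = c * l" if "k \<in> {1..K}" "W \<in> ?L" for k W
      unfolding Z_def by (rule length_tabulate) (use lenZ that in blast)
    show "length (X d W) = c * r" if "d \<in> demands N K" "W \<in> ?L" for d W
      unfolding X_def by (rule length_tabulate) (use lenX that in blast)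
    show "x (d k) = y (d k)"
      if d: "d \<in> demands N K" and k: "k \<in> {1..K}" and x: "x \<in> ?L" and y: "y \<in> ?L"
        and ez: "Z k x = Z k y" and ex: "X d x = X d y" for d k x y
    proof (rule block_ext)
      have dk: "d k \<in> {1..N}" using d k unfolding demands_def by blast
      show "length (x (d k)) = c * F" "length (y (d k)) = c * F" using len x y dk by blast+
      fix i assume i: "i < c"
      have "role i x (permute_demand K (\<alpha> i) (\<beta> i) d (\<alpha> i k)) = role i y (permute_demand K (\<alpha> i) (\<beta> i) d (\<alpha> i k))"
        using Z_eq[OF k x y] X_eq[OF d x y] ez ex i
        by (intro dec0[OF permute_demand_in[OF perm(1)[OF i] perm(2)[OF i] d] user[OF i k] role[OF x i] role[OF y i]]) blast+
      moreover have "\<beta> i (d k) \<in> {1..N}" using permutes_in_image[OF perm(2)[OF i]] dk by blast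
      ultimately show "block F i (x (d k)) = block F i (y (d k))"
        by (simp add: permute_demand_apply[OF perm(1)[OF i] k] role_def permutes_inverses[OF perm(2)[OF i]])
    qed
    show "symmetric_scheme N K (c * F) Z X"
      unfolding symmetric_scheme_def
    proof (intro allI impI)
      fix \<pi> \<sigma> :: "nat \<Rightarrow> nat" and A B :: "nat set" and E :: "(nat \<Rightarrow> nat) set"
      assume \<pi>: "\<pi> permutes {1..K}" and \<sigma>: "\<sigma> permutes {1..N}"
        and A: "A \<subseteq> {1..N}" and B: "B \<subseteq> {1..K}" and E: "E \<subseteq> demands N K"
      \<comment> \<open>In block \<open>T p\<close> user \<pi> k and file \<sigma> n play the roles
        that k and n play in block p. \<open>T\<close> permutes the blocks, with inverse
        \<open>T'\<close>, and \<tau> below is this permutation on indices.\<close>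
      define T where "T p = (fst p \<circ> inv \<pi>, snd p \<circ> inv \<sigma>)" for p :: "(nat \<Rightarrow> nat) \<times> (nat \<Rightarrow> nat)"
      define T' where "T' p = (fst p \<circ> \<pi>, snd p \<circ> \<sigma>)" for p :: "(nat \<Rightarrow> nat) \<times> (nat \<Rightarrow> nat)"
      have TT': "T p \<in> Q" "T' p \<in> Q" "T (T' p) = p" if "p \<in> Q" for p
        using that \<pi> \<sigma> unfolding T_def T'_def Q_def
        by (auto intro!: permutes_compose permutes_inv simp: o_assoc[symmetric] permutes_inv_o)
      have "\<forall>i<c. \<exists>j<c. ps ! j = T (ps ! i)"
        using TT'(1) ps nth_mem unfolding c_def by (metis in_set_conv_nth)
      then obtain \<tau> where \<tau>: "\<And>i. i < c \<Longrightarrow> \<tau> i < c" "\<And>i. i < c \<Longrightarrow> ps ! (\<tau> i) = T (ps ! i)" by metis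
      have \<tau>_surj: "\<exists>i<c. \<tau> i = j" if j: "j < c" for j
      proof -
        have pj: "ps ! j \<in> Q" using j ps nth_mem unfolding c_def by blast
        obtain i where i: "i < c" "ps ! i = T' (ps ! j)"
          using TT'(2)[OF pj] ps unfolding c_def by (metis in_set_conv_nth)
        then have "ps ! (\<tau> i) = ps ! j" using \<tau>(2)[OF i(1)] TT'(3)[OF pj] by simp
        then have "\<tau> i = j" using \<tau>(1)[OF i(1)] j ps(2) unfolding c_def by (simp add: nth_eq_iff_index_eq)
        then show ?thesis using i by blast
      qed
      have all_\<tau>: "(\<forall>i<c. P (\<tau> i)) \<longleftrightarrow> (\<forall>i<c. P i)" for P
        using \<tau>(1) \<tau>_surj by metis
      have \<alpha>\<tau>: "\<alpha> (\<tau> i) = \<alpha> i \<circ> inv \<pi>" and \<beta>\<tau>: "\<beta> (\<tau> i) = \<beta> i \<circ> inv \<sigma>" if "i < c" for i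
        using \<tau>(2)[OF that] by (simp_all add: \<alpha>_def \<beta>_def T_def)
      \<comment> \<open>File n receives the content of file \<sigma> n with blocks reordered by
        \<tau>, so that block i of the new library has the input of the old block \<tau> i; this is
        \<open>\<Phi>_role\<close>.\<close>
      define \<Phi> where "\<Phi> W = (\<lambda>n\<in>{1..N}. tabulate c (\<lambda>i. block F (\<tau> i) (W (\<sigma> n))))"
        for W :: "nat \<Rightarrow> bool list"
      have \<sigma>n: "\<sigma> n \<in> {1..N}" if "n \<in> {1..N}" for n
        using permutes_in_image[OF \<sigma>] that by blast
      have lb: "length (block F (\<tau> i) (W (\<sigma> n))) = F" if "i < c" "n \<in> {1..N}" "W \<in> ?L" for i n W
        using length_block[OF len[OF that(3) \<sigma>n[OF that(2)]] \<tau>(1)[OF that(1)]] .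
      have \<Phi>_block: "block F i (\<Phi> W n) = block F (\<tau> i) (W (\<sigma> n))"
        if "i < c" "n \<in> {1..N}" "W \<in> ?L" for i n W
      proof -
        have "block F i (tabulate c (\<lambda>i. block F (\<tau> i) (W (\<sigma> n)))) = block F (\<tau> i) (W (\<sigma> n))"
          by (rule block_tabulate[OF _ that(1)]) (use lb that in blast)
        then show ?thesis using that by (simp add: \<Phi>_def)
      qed
      have \<Phi>_in: "\<Phi> W \<in> ?L" if W: "W \<in> ?L" for W
      proof -
        have "length (tabulate c (\<lambda>i. block F (\<tau> i) (W (\<sigma> n)))) = c * F" if "n \<in> {1..N}" for n
          by (rule length_tabulate) (use lb that W in blast)
        then show ?thesis unfolding \<Phi>_def library_space_def by auto
      qed
      have \<Phi>_file: "\<Phi> x n = \<Phi> y n \<longleftrightarrow> x (\<sigma> n) = y (\<sigma> n)"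
        if "x \<in> ?L" "y \<in> ?L" "n \<in> {1..N}" for x y n
      proof
        assume e: "\<Phi> x n = \<Phi> y n"
        have "\<forall>i<c. block F (\<tau> i) (x (\<sigma> n)) = block F (\<tau> i) (y (\<sigma> n))"
          using \<Phi>_block that e by metis
        then have "\<forall>i<c. block F i (x (\<sigma> n)) = block F i (y (\<sigma> n))"
          using all_\<tau>[of "\<lambda>i. block F i (x (\<sigma> n)) = block F i (y (\<sigma> n))"] by blast
        then show "x (\<sigma> n) = y (\<sigma> n)"
          using block_ext[OF len[OF that(1) \<sigma>n[OF that(3)]] len[OF that(2) \<sigma>n[OF that(3)]]] by blast
      next
        assume "x (\<sigma> n) = y (\<sigma> n)"
        then show "\<Phi> x n = \<Phi> y n" by (simp add: \<Phi>_def)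
      qed
      have "inj_on \<Phi> ?L"
      proof (rule inj_onI)
        fix x y assume x: "x \<in> ?L" and y: "y \<in> ?L" and e: "\<Phi> x = \<Phi> y"
        have "x n = y n" if n: "n \<in> {1..N}" for n
        proof -
          have "inv \<sigma> n \<in> {1..N}" using permutes_in_image[OF permutes_inv[OF \<sigma>]] n by blast
          then show ?thesis
            using \<Phi>_file[OF x y, of "inv \<sigma> n"] e by (simp add: permutes_inverses[OF \<sigma>])
        qed
        then show "x = y"
          by (rule PiE_ext[OF x[unfolded library_space_def] y[unfolded library_space_def]])
      qed
      moreover have "\<Phi> ` ?L \<subseteq> ?L" using \<Phi>_in by blast
      ultimately have bij: "bij_betw \<Phi> ?L ?L"
        unfolding bij_betw_def using endo_inj_surj[OF finite_library] by blast
      have \<Phi>_role: "role i (\<Phi> W) = role (\<tau> i) W" if i: "i < c" and W: "W \<in> ?L" for i W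
        unfolding role_def
      proof (rule restrict_ext)
        fix m assume m: "m \<in> {1..N}"
        have "inv (\<beta> i) m \<in> {1..N}"
          using permutes_in_image[OF permutes_inv[OF perm(2)[OF i]]] m by blast
        then have "block F i (\<Phi> W (inv (\<beta> i) m)) = block F (\<tau> i) (W (\<sigma> (inv (\<beta> i) m)))"
          using \<Phi>_block[OF i _ W] by blast
        moreover have "inv (\<beta> (\<tau> i)) = \<sigma> \<circ> inv (\<beta> i)"
          unfolding \<beta>\<tau>[OF i] using \<sigma> perm(2)[OF i]
          by (simp add: o_inv_distrib permutes_bij bij_imp_bij_inv inv_inv_eq)
        ultimately show "block F i (\<Phi> W (inv (\<beta> i) m)) = block F (\<tau> i) (W (inv (\<beta> (\<tau> i)) m))" by simp
      qed
      show "H N (c * F) (\<lambda>W. (\<lambda>n\<in>A. W n, \<lambda>k\<in>B. Z k W, \<lambda>d\<in>E. X d W)) =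
        H N (c * F) (\<lambda>W. (\<lambda>n\<in>A. W (\<sigma> n), \<lambda>k\<in>B. Z (\<pi> k) W, \<lambda>d\<in>E. X (permute_demand K \<pi> \<sigma> d) W))"
      proof (rule H_kernel_bij[OF bij])
        fix x y assume x: "x \<in> ?L" and y: "y \<in> ?L"
        have files: "\<Phi> x n = \<Phi> y n \<longleftrightarrow> x (\<sigma> n) = y (\<sigma> n)" if "n \<in> A" for n
          using \<Phi>_file[OF x y] A that by blast
        have caches: "Z k (\<Phi> x) = Z k (\<Phi> y) \<longleftrightarrow> Z (\<pi> k) x = Z (\<pi> k) y" if "k \<in> B" for k
        proof -
          have k: "k \<in> {1..K}" "\<pi> k \<in> {1..K}" using that B permutes_in_image[OF \<pi>] by blast+
          have "\<alpha> i k = \<alpha> (\<tau> i) (\<pi> k)" if "i < c" for i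
            using \<alpha>\<tau>[OF that] by (simp add: permutes_inverses[OF \<pi>])
          then show ?thesis
            unfolding Z_eq[OF k(1) \<Phi>_in[OF x] \<Phi>_in[OF y]] Z_eq[OF k(2) x y]
            using all_\<tau>[of "\<lambda>i. Z0 (\<alpha> i (\<pi> k)) (role i x) = Z0 (\<alpha> i (\<pi> k)) (role i y)"]
            by (simp add: \<Phi>_role x y)
        qed
        have broadcasts: "X d (\<Phi> x) = X d (\<Phi> y) \<longleftrightarrow> X (permute_demand K \<pi> \<sigma> d) x = X (permute_demand K \<pi> \<sigma> d) y"
          if "d \<in> E" for d
        proof -
          let ?d = "permute_demand K \<pi> \<sigma> d"
          have d: "d \<in> demands N K" "?d \<in> demands N K" using that E permute_demand_in[OF \<pi> \<sigma>] by blast+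
          have "permute_demand K (\<alpha> i) (\<beta> i) d = permute_demand K (\<alpha> (\<tau> i)) (\<beta> (\<tau> i)) ?d" if "i < c" for i
            unfolding \<alpha>\<tau>[OF that] \<beta>\<tau>[OF that] using permute_demand_comp[OF perm(1)[OF that] \<pi> \<sigma>] by simp
          then show ?thesis
            unfolding X_eq[OF d(1) \<Phi>_in[OF x] \<Phi>_in[OF y]] X_eq[OF d(2) x y]
            using all_\<tau>[of "\<lambda>i. X0 (permute_demand K (\<alpha> i) (\<beta> i) ?d) (role i x)
                = X0 (permute_demand K (\<alpha> i) (\<beta> i) ?d) (role i y)"]
            by (simp add: \<Phi>_role x y)
        qed
        show "((\<lambda>n\<in>A. \<Phi> x n, \<lambda>k\<in>B. Z k (\<Phi> x), \<lambda>d\<in>E. X d (\<Phi> x)) =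
            (\<lambda>n\<in>A. \<Phi> y n, \<lambda>k\<in>B. Z k (\<Phi> y), \<lambda>d\<in>E. X d (\<Phi> y))) \<longleftrightarrow>
          ((\<lambda>n\<in>A. x (\<sigma> n), \<lambda>k\<in>B. Z (\<pi> k) x, \<lambda>d\<in>E. X (permute_demand K \<pi> \<sigma> d) x) =
            (\<lambda>n\<in>A. y (\<sigma> n), \<lambda>k\<in>B. Z (\<pi> k) y, \<lambda>d\<in>E. X (permute_demand K \<pi> \<sigma> d) y))"
          unfolding prod.inject restrict_eq_iff using files caches broadcasts by blast
      qed
    qed
  qed
qed

lemma achievable_of_plain_scheme:
  fixes M R :: real
  assumes "plain_scheme N K F l r" "F > 0" "real l \<le> M * F" "real r \<le> R * F" "M \<le> N"
  shows "achievable N K M R"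
proof (rule symmetrization[OF assms(1)])
  fix c Z X
  assume c: "c > 0" and sym: "symmetric_scheme N K (c * F) Z X"
    and Z: "\<And>k W. k \<in> {1..K} \<Longrightarrow> W \<in> library_space N (c * F) \<Longrightarrow> length (Z k W) = c * l"
    and X: "\<And>d W. d \<in> demands N K \<Longrightarrow> W \<in> library_space N (c * F) \<Longrightarrow> length (X d W) = c * r"
    and dec: "\<And>d k x y. d \<in> demands N K \<Longrightarrow> k \<in> {1..K} \<Longrightarrow> x \<in> library_space N (c * F) \<Longrightarrow>
        y \<in> library_space N (c * F) \<Longrightarrow> Z k x = Z k y \<Longrightarrow> X d x = X d y \<Longrightarrow> x (d k) = y (d k)"
  have pos: "0 \<le> M" "0 \<le> R"
    using assms(2) order_trans[OF of_nat_0_le_iff assms(3)] order_trans[OF of_nat_0_le_iff assms(4)]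
    by (simp_all add: zero_le_mult_iff)
  have "caching_scheme N K M R (c * F) Z X"
    unfolding caching_scheme_def
  proof (intro conjI ballI)
    have l: "real (c * l) \<le> M * real (c * F)" and r: "real (c * r) \<le> R * real (c * F)"
      using mult_left_mono[OF assms(3), of "real c"] mult_left_mono[OF assms(4), of "real c"]
      by (simp_all add: mult_ac)
    show "at_most_bits N (c * F) (Z k) (M * real (c * F))" if "k \<in> {1..K}" for k
      unfolding at_most_bits_def using Z[OF that] l by blast
    show "at_most_bits N (c * F) (X d) (R * real (c * F))" if "d \<in> demands N K" for d
      unfolding at_most_bits_def using X[OF that] r by blast
    show "\<exists>decode. \<forall>W\<in>library_space N (c * F). decode (Z k W) (X d W) = W (d k)"
      if d: "d \<in> demands N K" and k: "k \<in> {1..K}" for d k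
    proof -
      \<comment> \<open>The decoder picks any library consistent with what user k sees;
        determination makes its requested file the right one.\<close>
      define dcd where "dcd z u = (SOME W. W \<in> library_space N (c * F) \<and> Z k W = z \<and> X d W = u) (d k)" for z u
      have "dcd (Z k W) (X d W) = W (d k)" if W: "W \<in> library_space N (c * F)" for W
      proof -
        define V where "V = (SOME V. V \<in> library_space N (c * F) \<and> Z k V = Z k W \<and> X d V = X d W)"
        have "V \<in> library_space N (c * F) \<and> Z k V = Z k W \<and> X d V = X d W"
          unfolding V_def by (rule someI[of _ W]) (use W in simp)
        then have "V (d k) = W (d k)" using dec[OF d k _ W] by blast
        then show ?thesis by (simp add: dcd_def V_def)
      qed
      then show ?thesis by blast
    qed
  qed (use assms c pos in auto)
  then show ?thesis unfolding achievable_def using sym by blast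
qed

section \<open>Linear schemes over the field with four elements\<close>

text \<open>Over two elements a nonzero coefficient is 1, so the coefficient sum of a single user
  could not avoid 1. Four elements always leave a value other than 0 and a given c, and a symbol
  takes exactly two bits. \<open>GFa\<close> and \<open>GFb\<close> are the roots of t^2 + t +
  1.\<close>

datatype gf4 = GF0 | GF1 | GFa | GFb

lemma UNIV_gf4: "UNIV = {GF0, GF1, GFa, GFb}"
  using gf4.exhaust by blast

instance gf4 :: finite
  by standard (simp add: UNIV_gf4)

lemma card_gf4: "CARD(gf4) = 4"
  by (simp add: UNIV_gf4)

instantiation gf4 :: field
begin

definition "0 = GF0"
definition "1 = GF1"
definition "- x = (x :: gf4)"

fun plus_gf4 :: "gf4 \<Rightarrow> gf4 \<Rightarrow> gf4" where
  "plus_gf4 GF0 y = y"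
| "plus_gf4 x GF0 = x"
| "plus_gf4 GF1 GFa = GFb"
| "plus_gf4 GF1 GFb = GFa"
| "plus_gf4 GFa GF1 = GFb"
| "plus_gf4 GFb GF1 = GFa"
| "plus_gf4 GFa GFb = GF1"
| "plus_gf4 GFb GFa = GF1"
| "plus_gf4 x y = GF0"

definition "x - y = x + (y :: gf4)"

fun times_gf4 :: "gf4 \<Rightarrow> gf4 \<Rightarrow> gf4" where
  "times_gf4 GF0 y = GF0"
| "times_gf4 x GF0 = GF0"
| "times_gf4 GF1 y = y"
| "times_gf4 x GF1 = x"
| "times_gf4 GFa GFa = GFb"
| "times_gf4 GFb GFb = GFa"
| "times_gf4 x y = GF1"

fun inverse_gf4 :: "gf4 \<Rightarrow> gf4" where
  "inverse_gf4 GFa = GFb"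
| "inverse_gf4 GFb = GFa"
| "inverse_gf4 x = x"

definition "x div y = x * inverse (y :: gf4)"

instance
proof
  fix x y z :: gf4
  show "x + y + z = x + (y + z)" by (cases x; cases y; cases z) simp_all
  show "x + y = y + x" by (cases x; cases y) simp_all
  show "0 + x = x" by (simp add: zero_gf4_def)
  show "- x + x = 0" by (cases x) (simp_all add: zero_gf4_def uminus_gf4_def)
  show "x - y = x + - y" by (simp add: minus_gf4_def uminus_gf4_def)
  show "x * y * z = x * (y * z)" by (cases x; cases y; cases z) simp_all
  show "x * y = y * x" by (cases x; cases y) simp_all
  show "1 * x = x" by (cases x) (simp_all add: one_gf4_def)
  show "(x + y) * z = x * z + y * z" by (cases x; cases y; cases z) simp_all
  show "(0::gf4) \<noteq> 1" by (simp add: zero_gf4_def one_gf4_def)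
  show "x \<noteq> 0 \<Longrightarrow> inverse x * x = 1" by (cases x) (simp_all add: zero_gf4_def one_gf4_def)
  show "x div y = x * inverse y" by (rule divide_gf4_def)
  show "inverse (0::gf4) = 0" by (simp add: zero_gf4_def)
qed

end

section \<open>Coefficients of the coded broadcasts\<close>

lemma gf4_element_avoiding:
  obtains y :: gf4 where "y \<noteq> 0" "y \<noteq> c"
  using that[of GF1] that[of GFa] by (cases "c = GF1") (simp_all add: zero_gf4_def)

text \<open>Giving one index a value other than 0 and the target leaves a nonzero target for the
  rest.\<close>

lemma nonzero_sum_eq:
  assumes "finite S" "S \<noteq> {}" "c \<noteq> 0"
  shows "\<exists>g. (\<forall>i\<in>S. g i \<noteq> 0) \<and> (\<Sum>i\<in>S. g i) = (c :: gf4)"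
  using assms
proof (induction S arbitrary: c rule: finite_ne_induct)
  case (singleton i)
  then show ?case by (intro exI[of _ "\<lambda>_. c"]) simp
next
  case (insert i S)
  obtain y :: gf4 where y: "y \<noteq> 0" "y \<noteq> c" by (rule gf4_element_avoiding)
  obtain g where g: "\<forall>j\<in>S. g j \<noteq> 0" "(\<Sum>j\<in>S. g j) = c - y" using insert.IH[of "c - y"] y by auto
  have "(\<Sum>j\<in>S. (g(i := y)) j) = (\<Sum>j\<in>S. g j)" using insert by (intro sum.cong) auto
  then have "(\<Sum>j\<in>insert i S. (g(i := y)) j) = c" using g insert by simp
  moreover have "\<forall>j\<in>insert i S. (g(i := y)) j \<noteq> 0" using g y by simp
  ultimately show ?case by blast
qed

lemma nonzero_sum_neq_one:
  assumes "finite S"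
  shows "\<exists>g. (\<forall>i\<in>S. g i \<noteq> 0) \<and> (\<Sum>i\<in>S. g i) \<noteq> (1 :: gf4)"
proof (cases "S = {}")
  case False
  obtain y :: gf4 where "y \<noteq> 0" "y \<noteq> 1" by (rule gf4_element_avoiding)
  then show ?thesis using nonzero_sum_eq[OF assms False] by metis
qed simp

text \<open>The users other than m fall into classes by request, and each class is treated
  separately. A file other than \<open>d m\<close> is requested by someone other than m, so its
  class is nonempty and can reach sum 1. The class of \<open>d m\<close> may be empty, and then its
  sum 0 differs from 1 as well.\<close>

lemma coefficients_exist:
  assumes "d \<in> demands N K" "m \<in> {1..K}"
  shows "\<exists>g :: nat \<Rightarrow> gf4. (\<forall>i\<in>{1..K} - {m}. g i \<noteq> 0) \<and>
    (\<forall>n\<in>{1..N} - {d m}. (\<Sum>i\<in>{i\<in>{1..K} - {m}. d i = n}. g i) = 1) \<and>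
    (\<Sum>i\<in>{i\<in>{1..K} - {m}. d i = d m}. g i) \<noteq> 1"
proof -
  let ?C = "\<lambda>n. {i\<in>{1..K} - {m}. d i = n}"
  have "\<exists>g :: nat \<Rightarrow> gf4. (\<forall>i\<in>?C n. g i \<noteq> 0) \<and> (if n = d m then sum g (?C n) \<noteq> 1 else n \<in> {1..N} \<longrightarrow> sum g (?C n) = 1)" for n
  proof (cases "n = d m \<or> n \<notin> {1..N}")
    case True
    then show ?thesis using nonzero_sum_neq_one[of "?C n"] by (simp, blast)
  next
    case False
    then have "n \<in> d ` {1..K}" using assms(1) by (simp add: demands_def)
    then have "?C n \<noteq> {}" using False by blast
    then show ?thesis using nonzero_sum_eq[of "?C n" 1] False by simp
  qed
  then obtain G :: "nat \<Rightarrow> nat \<Rightarrow> gf4" where "\<forall>n. (\<forall>i\<in>?C n. G n i \<noteq> 0) \<and>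
      (if n = d m then sum (G n) (?C n) \<noteq> 1 else n \<in> {1..N} \<longrightarrow> sum (G n) (?C n) = 1)"
    using choice[of "\<lambda>n g. (\<forall>i\<in>?C n. g i \<noteq> 0) \<and>
      (if n = d m then sum g (?C n) \<noteq> 1 else n \<in> {1..N} \<longrightarrow> sum g (?C n) = (1 :: gf4))"] by blast
  then have G: "\<And>n i. i \<in> ?C n \<Longrightarrow> G n i \<noteq> 0"
    "\<And>n. if n = d m then sum (G n) (?C n) \<noteq> 1 else n \<in> {1..N} \<longrightarrow> sum (G n) (?C n) = 1" by blast+
  have s: "(\<Sum>i\<in>?C n. G (d i) i) = sum (G n) (?C n)" for n by (rule sum.cong) auto
  show ?thesis
  \<comment> \<open>Each user takes its coefficient from the class of its own request, which glues
    the separate choices together.\<close>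
  proof (intro exI[of _ "\<lambda>i. G (d i) i"] conjI ballI)
    show "G (d i) i \<noteq> 0" if "i \<in> {1..K} - {m}" for i using G(1)[of i "d i"] that by blast
    show "(\<Sum>i\<in>?C n. G (d i) i) = 1" if "n \<in> {1..N} - {d m}" for n
      unfolding s using G(2)[of n] that by simp
    show "(\<Sum>i\<in>?C (d m). G (d i) i) \<noteq> 1" unfolding s using G(2)[of "d m"] by simp
  qed
qed

section \<open>The two corner schemes\<close>

lemma card_gf4_functions: "finite I \<Longrightarrow> card (I \<rightarrow>\<^sub>E (UNIV :: gf4 set)) = 2 ^ (2 * card I)"
  by (simp add: card_PiE card_gf4 power_mult)

lemma restrict_in_PiE_UNIV: "restrict f A \<in> A \<rightarrow>\<^sub>E UNIV"
  by (simp add: PiE_def)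

lemma card_image_le_of_subset: "f ` A \<subseteq> B \<Longrightarrow> finite B \<Longrightarrow> card B = n \<Longrightarrow> card (f ` A) \<le> n"
  using card_mono by blast

lemma demand_in: "d \<in> demands N K \<Longrightarrow> k \<in> {1..K} \<Longrightarrow> d k \<in> {1..N}"
  unfolding demands_def by blast

text \<open>Symbol j of every file is missing only from the cache of user j. In the broadcast sum of
  the missing requested symbols, user k knows every term but its own.\<close>

lemma plain_scheme_uncoded:
  "plain_scheme N K (2 * K) (2 * (N * (K - 1))) 2"
proof -
  define P where "P = {1..K} \<rightarrow>\<^sub>E (UNIV :: gf4 set)"
  define Z where "Z k w = (\<lambda>(n, j)\<in>{1..N} \<times> ({1..K} - {k}). w n j)" for k and w :: "nat \<Rightarrow> nat \<Rightarrow> gf4"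
  define X where "X d w = (\<Sum>i\<in>{1..K}. w (d i) i)" for d :: "nat \<Rightarrow> nat" and w :: "nat \<Rightarrow> nat \<Rightarrow> gf4"
  show ?thesis
  proof (rule plain_scheme_of_alphabet[of P _ K Z N _ X])
    show "finite P" unfolding P_def by (intro finite_PiE) auto
    show "card P = 2 ^ (2 * K)" unfolding P_def by (subst card_gf4_functions) auto
    show "card (Z k ` ({1..N} \<rightarrow>\<^sub>E P)) \<le> 2 ^ (2 * (N * (K - 1)))" if "k \<in> {1..K}" for k
    proof (rule card_image_le_of_subset[where B = "({1..N} \<times> ({1..K} - {k})) \<rightarrow>\<^sub>E UNIV"])
      show "card (({1..N} \<times> ({1..K} - {k})) \<rightarrow>\<^sub>E (UNIV :: gf4 set)) = 2 ^ (2 * (N * (K - 1)))"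
        using that by (subst card_gf4_functions) (auto simp: card_cartesian_product)
      show "Z k ` ({1..N} \<rightarrow>\<^sub>E P) \<subseteq> ({1..N} \<times> ({1..K} - {k})) \<rightarrow>\<^sub>E UNIV"
        unfolding Z_def by (intro image_subsetI restrict_in_PiE_UNIV)
    qed (intro finite_PiE, simp_all)
    show "card (X d ` ({1..N} \<rightarrow>\<^sub>E P)) \<le> 2 ^ 2" for d
      using card_mono[of UNIV "X d ` ({1..N} \<rightarrow>\<^sub>E P)"] by (simp add: card_gf4)
    fix d k x y
    assume d: "d \<in> demands N K" and k: "k \<in> {1..K}" and x: "x \<in> {1..N} \<rightarrow>\<^sub>E P" and y: "y \<in> {1..N} \<rightarrow>\<^sub>E P"
      and ez: "Z k x = Z k y" and ex: "X d x = X d y"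
    have Z: "x n j = y n j" if "n \<in> {1..N}" "j \<in> {1..K} - {k}" for n j
    proof -
      have "(n, j) \<in> {1..N} \<times> ({1..K} - {k})" using that by simp
      then show ?thesis using ez unfolding Z_def restrict_eq_iff by fastforce
    qed
    have "(\<Sum>i\<in>{1..K} - {k}. x (d i) i) = (\<Sum>i\<in>{1..K} - {k}. y (d i) i)"
      by (intro sum.cong Z demand_in[OF d]) auto
    then have xk: "x (d k) k = y (d k) k"
      using ex k unfolding X_def by (simp add: sum.remove[of "{1..K}" k] del: One_nat_def)
    have dk: "d k \<in> {1..N}" by (rule demand_in[OF d k])
    show "x (d k) = y (d k)"
    proof (rule PiE_ext)
      show "x (d k) \<in> {1..K} \<rightarrow>\<^sub>E UNIV" "y (d k) \<in> {1..K} \<rightarrow>\<^sub>E UNIV" using x y dk unfolding P_def by blast+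
      show "x (d k) j = y (d k) j" if "j \<in> {1..K}" for j
        using xk Z[OF dk, of j] that by (cases "j = k") auto
    qed
  qed
qed

text \<open>Symbols of a file are indexed by ordered pairs \<open>(j, m)\<close> with \<open>j \<noteq> m\<close>. User \<open>k\<close> caches all
  symbols not mentioning \<open>k\<close>; the symbols \<open>(j, k)\<close> of each file only up to a common shift; and the
  sum over all files of that shift. The \<open>m\<close>-th broadcast symbol, for \<open>m \<noteq> k\<close>, delivers the
  symbol \<open>(k, m)\<close> to user \<open>k\<close>, while the \<open>k\<close>-th one is a combination of the unknown shifts which
  differs from the cached sum only in the coefficient of the requested file.\<close>

lemma plain_scheme_coded:
  assumes "2 \<le> K"
  shows "plain_scheme N K (2 * (K * (K - 1))) (2 * (N * K * (K - 2) + 1)) (2 * K)"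
proof -
  define I where "I = (SIGMA j:{1..K}. {1..K} - {j})"
  define P where "P = I \<rightarrow>\<^sub>E (UNIV :: gf4 set)"
  \<comment> \<open>Some user other than k; the common shift of the symbols (j, k) is measured at j
    = \<open>ref k\<close>.\<close>
  define ref where "ref k = (if k = 1 then 2 else 1 :: nat)" for k :: nat
  have ref: "ref k \<in> {1..K}" "ref k \<noteq> k" for k using assms by (auto simp: ref_def)
  define C where "C k = {1..N} \<times> (SIGMA j:{1..K} - {k}. {1..K} - {k} - {j})" for k
  define B where "B k = {1..N} \<times> ({1..K} - {k} - {ref k})" for k
  define Z where "Z k w = ((\<lambda>(n, p)\<in>C k. w n p), (\<lambda>(n, j)\<in>B k. w n (j, k) - w n (ref k, k)),
    (\<Sum>n\<in>{1..N}. w n (ref k, k)))" for k and w :: "nat \<Rightarrow> nat \<times> nat \<Rightarrow> gf4"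
  define g :: "(nat \<Rightarrow> nat) \<Rightarrow> nat \<Rightarrow> nat \<Rightarrow> gf4" where
    "g d m = (SOME g. (\<forall>i\<in>{1..K} - {m}. g i \<noteq> 0) \<and>
      (\<forall>n\<in>{1..N} - {d m}. (\<Sum>i\<in>{i\<in>{1..K} - {m}. d i = n}. g i) = 1) \<and>
      (\<Sum>i\<in>{i\<in>{1..K} - {m}. d i = d m}. g i) \<noteq> 1)" for d m
  have g: "\<And>i. i \<in> {1..K} - {m} \<Longrightarrow> g d m i \<noteq> 0"
    "\<And>n. n \<in> {1..N} - {d m} \<Longrightarrow> (\<Sum>i\<in>{i\<in>{1..K} - {m}. d i = n}. g d m i) = 1"
    "(\<Sum>i\<in>{i\<in>{1..K} - {m}. d i = d m}. g d m i) \<noteq> 1"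
    if "d \<in> demands N K" "m \<in> {1..K}" for d m
    using someI_ex[OF coefficients_exist[OF that]] unfolding g_def[symmetric] by blast+
  define X where "X d w = (\<lambda>m\<in>{1..K}. \<Sum>i\<in>{1..K} - {m}. g d m i * w (d i) (i, m))"
    for d and w :: "nat \<Rightarrow> nat \<times> nat \<Rightarrow> gf4"
  have fin: "finite I" "finite (C k)" "finite (B k)" for k
    unfolding I_def C_def B_def by auto
  have card_I: "card I = K * (K - 1)" unfolding I_def by simp
  have card_C: "card (C k) = N * ((K - 1) * (K - 2))" if "k \<in> {1..K}" for k
    using that unfolding C_def by (simp add: card_cartesian_product numeral_2_eq_2)
  have card_B: "card (B k) = N * (K - 2)" if "k \<in> {1..K}" for k
    using that ref[of k] unfolding B_def by (simp add: card_cartesian_product numeral_2_eq_2)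
  have KK: "(K - 1) * (K - 2) + (K - 2) = K * (K - 2)"
    using assms by (cases K) auto
  show ?thesis
  proof (rule plain_scheme_of_alphabet[of P _ K Z N _ X])
    show "finite P" unfolding P_def using fin by (intro finite_PiE) auto
    show "card P = 2 ^ (2 * (K * (K - 1)))" unfolding P_def by (simp add: card_gf4_functions fin card_I)
    show "card (Z k ` ({1..N} \<rightarrow>\<^sub>E P)) \<le> 2 ^ (2 * (N * K * (K - 2) + 1))" if k: "k \<in> {1..K}" for k
    proof (rule card_image_le_of_subset[where B = "(C k \<rightarrow>\<^sub>E UNIV) \<times> (B k \<rightarrow>\<^sub>E UNIV) \<times> UNIV"])
      have "card ((C k \<rightarrow>\<^sub>E (UNIV::gf4 set)) \<times> (B k \<rightarrow>\<^sub>E (UNIV::gf4 set)) \<times> (UNIV::gf4 set))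
        = 2 ^ (2 * (N * ((K - 1) * (K - 2)))) * (2 ^ (2 * (N * (K - 2))) * 2 ^ 2)"
        by (simp add: card_cartesian_product card_gf4_functions fin card_C[OF k] card_B[OF k] card_gf4)
      also have "\<dots> = 2 ^ (2 * (N * ((K - 1) * (K - 2) + (K - 2)) + 1))"
        by (simp add: power_add[symmetric] algebra_simps)
      finally show "card ((C k \<rightarrow>\<^sub>E (UNIV::gf4 set)) \<times> (B k \<rightarrow>\<^sub>E (UNIV::gf4 set)) \<times> (UNIV::gf4 set))
        = 2 ^ (2 * (N * K * (K - 2) + 1))" unfolding KK by (simp add: mult.assoc)
      show "Z k ` ({1..N} \<rightarrow>\<^sub>E P) \<subseteq> (C k \<rightarrow>\<^sub>E UNIV) \<times> (B k \<rightarrow>\<^sub>E UNIV) \<times> UNIV"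
        unfolding Z_def by (intro image_subsetI SigmaI restrict_in_PiE_UNIV UNIV_I)
    qed (intro finite_cartesian_product finite_PiE fin, simp_all)
    show "card (X d ` ({1..N} \<rightarrow>\<^sub>E P)) \<le> 2 ^ (2 * K)" for d
    proof (rule card_image_le_of_subset[where B = "{1..K} \<rightarrow>\<^sub>E UNIV"])
      show "card ({1..K} \<rightarrow>\<^sub>E (UNIV :: gf4 set)) = 2 ^ (2 * K)" by (subst card_gf4_functions) auto
      show "X d ` ({1..N} \<rightarrow>\<^sub>E P) \<subseteq> {1..K} \<rightarrow>\<^sub>E UNIV"
        unfolding X_def by (intro image_subsetI restrict_in_PiE_UNIV)
    qed (intro finite_PiE, simp_all)
    fix d k x y
    assume d: "d \<in> demands N K" and k: "k \<in> {1..K}" and x: "x \<in> {1..N} \<rightarrow>\<^sub>E P" and y: "y \<in> {1..N} \<rightarrow>\<^sub>E P"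
      and ez: "Z k x = Z k y" and ex: "X d x = X d y"
    have dk: "d k \<in> {1..N}" by (rule demand_in[OF d k])
    \<comment> \<open>The shift by which two libraries with the same cache k can differ on the
      symbols (j, k) of file n; the cached sum forces these shifts to add up to 0.\<close>
    define v where "v n = x n (ref k, k) - y n (ref k, k)" for n
    have uncoded: "x n (j, m) = y n (j, m)"
      if "n \<in> {1..N}" "j \<in> {1..K}" "m \<in> {1..K}" "j \<noteq> m" "j \<noteq> k" "m \<noteq> k" for n j m
    proof -
      have "(n, j, m) \<in> C k" using that by (simp add: C_def)
      then show ?thesis using ez unfolding Z_def prod.inject restrict_eq_iff by fastforce
    qed
    have shift: "x n (j, k) - y n (j, k) = v n" if "n \<in> {1..N}" "j \<in> {1..K}" "j \<noteq> k" for n j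
    proof (cases "j = ref k")
      case False
      then have "(n, j) \<in> B k" using that by (simp add: B_def)
      then have "x n (j, k) - x n (ref k, k) = y n (j, k) - y n (ref k, k)"
        using ez unfolding Z_def prod.inject restrict_eq_iff by fastforce
      then show ?thesis unfolding v_def by (simp add: algebra_simps)
    qed (simp add: v_def)
    have sum_v: "(\<Sum>n\<in>{1..N}. v n) = 0"
      using ez unfolding v_def Z_def by (simp add: sum_subtractf)
    have broadcast: "(\<Sum>i\<in>{1..K} - {m}. g d m i * (x (d i) (i, m) - y (d i) (i, m))) = 0" if "m \<in> {1..K}" for m
    proof -
      have "(\<Sum>i\<in>{1..K} - {m}. g d m i * x (d i) (i, m)) = (\<Sum>i\<in>{1..K} - {m}. g d m i * y (d i) (i, m))"
        using ex that unfolding X_def restrict_eq_iff by blast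
      then show ?thesis by (simp add: right_diff_distrib sum_subtractf)
    qed
    \<comment> \<open>All other terms of broadcast symbol m are symbols (i, m) not mentioning k,
      hence cached; what remains is symbol (k, m) with a nonzero coefficient.\<close>
    have own: "x (d k) (k, m) = y (d k) (k, m)" if m: "m \<in> {1..K}" "m \<noteq> k" for m
    proof -
      have "(\<Sum>i\<in>{1..K} - {m}. g d m i * (x (d i) (i, m) - y (d i) (i, m)))
        = g d m k * (x (d k) (k, m) - y (d k) (k, m))
          + (\<Sum>i\<in>{1..K} - {m} - {k}. g d m i * (x (d i) (i, m) - y (d i) (i, m)))"
        using k m by (intro sum.remove) auto
      also have "(\<Sum>i\<in>{1..K} - {m} - {k}. g d m i * (x (d i) (i, m) - y (d i) (i, m))) = 0"
        using m uncoded demand_in[OF d] by (intro sum.neutral) auto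
      finally have "g d m k * (x (d k) (k, m) - y (d k) (k, m)) = 0" using broadcast[OF m(1)] by simp
      then show ?thesis using g(1)[OF d m(1), of k] k m by simp
    qed
    \<comment> \<open>Broadcast symbol k is a linear relation among the shifts with coefficient 1 at
      every file but \<open>d k\<close>. Subtracting the relation that the shifts sum to 0 leaves
      \<open>v (d k)\<close> times a nonzero factor.\<close>
    have "v (d k) = 0"
    proof -
      let ?s = "\<lambda>n. \<Sum>i\<in>{i\<in>{1..K} - {k}. d i = n}. g d k i"
      have "0 = (\<Sum>i\<in>{1..K} - {k}. g d k i * v (d i))"
        unfolding broadcast[OF k, symmetric] using shift demand_in[OF d] by (intro sum.cong) auto
      also have "\<dots> = (\<Sum>n\<in>{1..N}. \<Sum>i\<in>{i\<in>{1..K} - {k}. d i = n}. g d k i * v (d i))"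
        using demand_in[OF d] by (intro sum.group[symmetric]) auto
      also have "\<dots> = (\<Sum>n\<in>{1..N}. ?s n * v n)"
        unfolding sum_distrib_right by (intro sum.cong) auto
      also have "\<dots> = ?s (d k) * v (d k) + (\<Sum>n\<in>{1..N} - {d k}. ?s n * v n)"
        using dk by (intro sum.remove) auto
      also have "(\<Sum>n\<in>{1..N} - {d k}. ?s n * v n) = (\<Sum>n\<in>{1..N} - {d k}. v n)"
        using g(2)[OF d k] by (intro sum.cong) auto
      also have "\<dots> = - v (d k)"
        using sum_v sum.remove[of "{1..N}" "d k" v] dk by (simp add: eq_neg_iff_add_eq_0 add.commute)
      finally have "(?s (d k) - 1) * v (d k) = 0" by (simp add: left_diff_distrib)
      then show ?thesis using g(3)[OF d k] by simp
    qed
    then have rest: "x (d k) (j, k) = y (d k) (j, k)" if "j \<in> {1..K}" "j \<noteq> k" for j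
      using shift[OF dk that] by simp
    show "x (d k) = y (d k)"
    proof (rule PiE_ext)
      show "x (d k) \<in> I \<rightarrow>\<^sub>E UNIV" "y (d k) \<in> I \<rightarrow>\<^sub>E UNIV" using x y dk unfolding P_def by blast+
      fix p assume "p \<in> I"
      then obtain j m where p: "p = (j, m)" "j \<in> {1..K}" "m \<in> {1..K}" "j \<noteq> m" unfolding I_def by blast
      consider "j = k" | "m = k" | "j \<noteq> k" "m \<noteq> k" by blast
      then show "x (d k) p = y (d k) p"
        using own rest uncoded[OF dk p(2-4)] p by cases auto
    qed
  qed
qed

section \<open>The exact tradeoff\<close>

text \<open>The factor K - 1 on the uncoded copies brings both ingredients to the file size 2 K (K -
  1), so that a : b is the ratio of the shares of a file.\<close>

lemma plain_scheme_mixture: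
  assumes "2 \<le> K"
  shows "plain_scheme N K ((a + b) * (2 * (K * (K - 1))))
    (a * (2 * (N * K * (K - 2) + 1)) + b * (2 * (N * (K - 1) * (K - 1))))
    (a * (2 * K) + b * (2 * (K - 1)))"
proof -
  have "plain_scheme N K (a * (2 * (K * (K - 1))) + b * (K - 1) * (2 * K))
    (a * (2 * (N * K * (K - 2) + 1)) + b * (K - 1) * (2 * (N * (K - 1))))
    (a * (2 * K) + b * (K - 1) * 2)"
    by (intro plain_scheme_add plain_scheme_copies plain_scheme_coded plain_scheme_uncoded assms)
  moreover have "a * (2 * (K * (K - 1))) + b * (K - 1) * (2 * K) = (a + b) * (2 * (K * (K - 1)))"
    "b * (K - 1) * (2 * (N * (K - 1))) = b * (2 * (N * (K - 1) * (K - 1)))"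
    "b * (K - 1) * 2 = b * (2 * (K - 1))"
    by (simp_all only: distrib_right distrib_left mult_ac)
  ultimately show ?thesis by (simp only:)
qed

text \<open>For N and K at least 2 this is (N K (K - 2) + 1) / (K (K - 1)), the ratio of cache size
  to file size in \<open>plain_scheme_coded\<close>.\<close>

definition corner_memory :: "nat \<Rightarrow> nat \<Rightarrow> real" where
  "corner_memory N K = real N / real K * (real K - 2 + (real K - 2 + 1 / real N) / (real K - 1))"

definition tradeoff_line :: "nat \<Rightarrow> nat \<Rightarrow> real \<Rightarrow> real" where
  "tradeoff_line N K M = (real K * real N - 1) / (real K * (real N - 1)) - 1 / (real N - 1) * M"

lemma corner_memory_scaled:
  assumes "2 \<le> N" "2 \<le> K"
  shows "corner_memory N K * (real K * (real K - 1)) = real N * real K * (real K - 2) + 1"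
proof -
  define j t where "j = real K - 1" and "t = real K - 2 + 1 / real N"
  have "real K \<noteq> 0" "j \<noteq> 0" using assms by (simp_all add: j_def)
  then have "real N / real K * (real K - 2 + t / j) * (real K * j) = real N * (real K - 2) * j + real N * t"
    by (simp add: distrib_left distrib_right)
  moreover have "real N * t = real N * (real K - 2) + 1"
    using assms by (simp add: t_def distrib_left)
  ultimately have "corner_memory N K * (real K * j) = real N * (real K - 2) * j + (real N * (real K - 2) + 1)"
    unfolding corner_memory_def j_def[symmetric] t_def[symmetric] by simp
  then show ?thesis unfolding j_def by (simp add: algebra_simps)
qed

lemma tradeoff_line_scaled:
  assumes "2 \<le> N" "N \<le> K"
  shows "real K * (real N - 1) * tradeoff_line N K M = real K * real N - 1 - real K * M"
proof -
  define m where "m = real N - 1"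
  have "real K \<noteq> 0" "m \<noteq> 0" using assms by (auto simp: m_def)
  then show ?thesis unfolding tradeoff_line_def m_def[symmetric]
    by (simp add: right_diff_distrib[of "real K * m" "_ / _"])
qed

lemma achievable_rational:
  assumes N: "2 \<le> N" and K: "N \<le> K" and M: "M \<in> \<rat>"
    and lo: "corner_memory N K \<le> M" and hi: "M \<le> real N / real K * (real K - 1)"
  shows "achievable N K M (tradeoff_line N K M)"
proof -
  let ?M1 = "corner_memory N K"
  let ?D = "real K * (real K - 1)"
  define M2 where "M2 = real N / real K * (real K - 1)"
  have K2: "2 \<le> K" using N K by simp
  have D: "?D > 0" using K2 by simp
  have M1: "?M1 * ?D = real N * real K * (real K - 2) + 1"
    by (rule corner_memory_scaled[OF N K2])
  have M2: "M2 * ?D = real N * (real K - 1) * (real K - 1)"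
    using K2 by (simp add: M2_def)
  have diff: "(M2 - ?M1) * ?D = real N - 1"
    unfolding left_diff_distrib M1 M2 by (simp add: algebra_simps)
  have "(M2 - ?M1) * ?D > 0" unfolding diff using N by simp
  then have lt: "?M1 < M2" using D by (simp add: zero_less_mult_iff)
  \<comment> \<open>Position of M on the segment from the coded to the uncoded corner. It is a
    fraction b / n, realised by giving b of n shares to the uncoded scheme.\<close>
  define \<theta> where "\<theta> = (M - ?M1) / (M2 - ?M1)"
  have \<theta>: "0 \<le> \<theta>" "\<theta> \<le> 1" "M = ?M1 + \<theta> * (M2 - ?M1)"
    using lo hi[folded M2_def] lt by (simp_all add: \<theta>_def divide_le_eq)
  have "\<theta> \<in> \<rat>" unfolding \<theta>_def M2_def corner_memory_def using M by simp
  then obtain b n :: nat where n: "n \<noteq> 0" and bn: "\<bar>\<theta>\<bar> = real b / real n"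
    by (rule Rats_abs_nat_div_natE)
  have b: "b \<le> n" using \<theta> bn n by (simp add: divide_le_eq)
  define a where "a = n - b"
  have an: "real n = real a + real b" using b by (simp add: a_def)
  have b\<theta>: "real b = n * \<theta>" using bn \<theta> n by simp
  have nM: "real n * M = real a * ?M1 + real b * M2"
  proof -
    have "real n * M = n * ?M1 + (n * \<theta>) * (M2 - ?M1)" by (subst \<theta>(3)) (simp add: algebra_simps)
    also have "\<dots> = real n * ?M1 + real b * (M2 - ?M1)" unfolding b\<theta> ..
    also have "\<dots> = real a * ?M1 + real b * M2" unfolding an by (simp add: algebra_simps)
    finally show ?thesis .
  qed
  have K1: "real (K - 1) = real K - 1" "real (K - 2) = real K - 2" using K2 by simp_all
  let ?F = "(a + b) * (2 * (K * (K - 1)))"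
  have F: "real ?F = 2 * (real n * ?D)" 
    unfolding an of_nat_mult of_nat_add K1 by (simp add: algebra_simps)
  have nMD: "real n * M * ?D = real a * (real N * real K * (real K - 2) + 1)
      + real b * (real N * (real K - 1) * (real K - 1))"
    unfolding nM distrib_right[of _ _ ?D] mult.assoc[of _ _ ?D] M1 M2 ..
  show ?thesis
  proof (rule achievable_of_plain_scheme[OF plain_scheme_mixture[OF K2, of N a b]])
    show "?F > 0" using K2 n b by (simp add: a_def)
    show "real (a * (2 * (N * K * (K - 2) + 1)) + b * (2 * (N * (K - 1) * (K - 1)))) \<le> M * real ?F"
      unfolding F unfolding of_nat_mult of_nat_add K1 using nMD by (simp add: algebra_simps)
    have "M2 \<le> real N" using K2 by (simp add: M2_def field_simps)
    then show "M \<le> real N" using hi[folded M2_def] by linarith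
    \<comment> \<open>The rate is compared after multiplication by N - 1, which clears the
      denominator of the line.\<close>
    have "(real N - 1) * (real n * tradeoff_line N K M * ?D)
        = real n * (real K - 1) * (real K * (real N - 1) * tradeoff_line N K M)" by simp
    also have "\<dots> = real n * (real K * real N - 1) * (real K - 1) - real n * M * ?D"
      unfolding tradeoff_line_scaled[OF N K] by (simp add: algebra_simps)
    also have "\<dots> = (real N - 1) * (real a * real K + real b * (real K - 1))"
      unfolding nMD unfolding an by (simp add: algebra_simps)
    finally have "real n * tradeoff_line N K M * ?D = real a * real K + real b * (real K - 1)"
      using N by simp
    then show "real (a * (2 * K) + b * (2 * (K - 1))) \<le> tradeoff_line N K M * real ?F"
      unfolding F unfolding of_nat_mult of_nat_add K1 by (simp add: algebra_simps)
  qed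
qed

lemma achievable_mono:
  assumes "achievable N K M R" "M \<le> M'" "M' \<le> N"
  shows "achievable N K M' R"
proof -
  obtain F Z X where s: "caching_scheme N K M R F Z X" and sym: "symmetric_scheme N K F Z X"
    using assms(1) unfolding achievable_def by blast
  have bits: "at_most_bits N F V (M' * real F)" if "at_most_bits N F V (M * real F)" for V
    using that order_trans[OF _ mult_right_mono[OF assms(2), of "real F"]]
    unfolding at_most_bits_def by fastforce
  have "caching_scheme N K M' R F Z X"
    using s assms(2,3) bits unfolding caching_scheme_def by auto
  then show ?thesis unfolding achievable_def using sym by blast
qed

lemma tradeoff_line_lower_bound:
  assumes "2 \<le> N" "N \<le> K" "K < 2 * N" "achievable N K M R"
  shows "tradeoff_line N K M \<le> R"
proof -
  obtain F Z X where s: "caching_scheme N K M R F Z X" "symmetric_scheme N K F Z X"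
    using assms(4) unfolding achievable_def by blast
  interpret symmetric_caching N K F M R Z X
    by (rule symmetric_caching.intro[OF s assms(1-3)])
  have "real K * (real N - 1) * tradeoff_line N K M \<le> real K * (real N - 1) * R"
    unfolding tradeoff_line_scaled[OF assms(1,2)] using tradeoff_lower_bound by (simp add: algebra_simps)
  moreover have "0 < real K * (real N - 1)" using assms(1,2) by simp
  ultimately show ?thesis by (simp only: mult_le_cancel_left_pos)
qed

text \<open>The upper end of the range is the memory of the uncoded scheme, where the line has the
  value 1 / K. Some upper end below N is unavoidable, since the line is negative at M = N. At
  rational M memory sharing realises the point exactly, so there the infimum is attained.\<close>

theorem theorem3:
  fixes N K :: nat and M :: real
  assumes "2 \<le> N"
    and "\<lceil>(real K + 1) / 2\<rceil> \<le> int N" and "N \<le> K"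
    and "M \<ge> real N / real K * (real K - 2 + (real K - 2 + 1 / real N) / (real K - 1))"
    and "M \<le> real N / real K * (real K - 1)"
  shows "Rstar N K M =
           (real K * real N - 1) / (real K * (real N - 1)) - 1 / (real N - 1) * M
         \<and> (M \<in> \<rat> \<longrightarrow> achievable N K M (Rstar N K M))"
proof -
  \<comment> \<open>Over the integers the ceiling condition says K < 2 N.\<close>
  have "(real K + 1) / 2 \<le> real N" using assms(2) by (simp add: ceiling_le_iff)
  then have "real (K + 1) \<le> real (2 * N)" by simp
  then have K: "K < 2 * N" unfolding of_nat_le_iff by simp
  have lo: "corner_memory N K \<le> M" using assms(4) by (simp add: corner_memory_def)
  have "real N / real K * (real K - 1) \<le> real N" using assms(1,3) by (simp add: field_simps)
  then have MN: "M \<le> N" using assms(5) by linarith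
  note lower = tradeoff_line_lower_bound[OF assms(1,3) K]
  have approx: "\<exists>R. achievable N K M R \<and> R \<le> tradeoff_line N K M + e" if e: "e > 0" for e
  proof (cases "M \<in> \<rat>")
    case True
    then show ?thesis using achievable_rational[OF assms(1,3) _ lo assms(5)] e by force
  next
    case False
    have "corner_memory N K \<in> \<rat>" by (simp add: corner_memory_def)
    then have "corner_memory N K < M" using lo False by (cases "corner_memory N K = M") auto
    \<comment> \<open>For irrational M, a scheme for a rational q slightly below M leaves the excess
      memory idle. The line has slope -1 / (N - 1), so a distance below e (N - 1) costs at most e in
      rate.\<close>
    then have "max (corner_memory N K) (M - e * (real N - 1)) < M" using e assms(1) by simp
    then obtain q where q: "q \<in> \<rat>" "max (corner_memory N K) (M - e * (real N - 1)) < q" "q < M"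
      using Rats_dense_in_real by blast
    have "achievable N K q (tradeoff_line N K q)"
      using q assms(5) by (intro achievable_rational[OF assms(1,3)]) auto
    then have "achievable N K M (tradeoff_line N K q)"
      by (rule achievable_mono) (use q MN in auto)
    moreover have "tradeoff_line N K q \<le> tradeoff_line N K M + e"
    proof -
      have "(M - q) / (real N - 1) \<le> e" using q assms(1) by (simp add: divide_le_eq)
      then show ?thesis unfolding tradeoff_line_def by (simp add: diff_divide_distrib)
    qed
    ultimately show ?thesis by blast
  qed
  have "Rstar N K M = tradeoff_line N K M"
    unfolding Rstar_def
  proof (rule antisym)
    have bdd: "bdd_below {R. achievable N K M R}" using lower by (intro bdd_belowI) auto
    show "Inf {R. achievable N K M R} \<le> tradeoff_line N K M"
    proof (rule field_le_epsilon)
      fix e :: real assume "e > 0"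
      then obtain R where "achievable N K M R" "R \<le> tradeoff_line N K M + e" using approx by blast
      then show "Inf {R. achievable N K M R} \<le> tradeoff_line N K M + e"
        using cInf_lower[OF _ bdd, of R] by simp
    qed
    show "tradeoff_line N K M \<le> Inf {R. achievable N K M R}"
      using approx[of 1] lower by (intro cInf_greatest) auto
  qed
  then show ?thesis
    using achievable_rational[OF assms(1,3) _ lo assms(5)] by (simp add: tradeoff_line_def)
qed

end
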